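(* Given integers $n\ge 0$ and $k\ge 1$, we have $$C_{\{n,k\}}=\sum_{P}\operatorname{wt}P,$$ where the sum is over all Fuss-Catalan partial tilings $P$ associated with lattice paths going from $(n-1,0)$ to $(0,(k+1)n)$ in $\delta_{(k+1)n}$. Thus $C_{\{n,k\}}\in\mathbb{N}[s,t]$.
   Context: Let $s,t$ be indeterminates and $\mathbb{N}=\{0,1,2,\dots\}$. The Lucas sequence is $\{0\}=0$, $\{1\}=1$, $\{n\}=s\{n-1\}+t\{n-2\}$ for $n\ge 2$; $\{n\}!=\{1\}\{2\}\cdots\{n\}$ with $\{0\}!=1$; $\left\{{n\atop k}\right\}=\frac{\{n\}!}{\{k\}!\{n-k\}!}$ for $0\le k\le n$. The Lucas analogue of the Fuss-Catalan number is $C_{\{n,k\}}=\frac{1}{\{kn+1\}}\left\{{(k+1)n\atop n}\right\}$. The staircase $\delta_N=(N-1,N-2,\dots,1)$ is drawn in the first quadrant with unit boxes, southwest corner at the origin, the $i$th row from the bottom having $N-i$ boxes (row $N$ has $0$ boxes). The unit segments from $(N-1,0)$ to $(N,0)$ and from $(0,N-1)$ to $(0,N)$ are also part of the diagram. A tiling of $\delta_N$ is a tiling of each row by monominoes (one box) and dominoes (two adjacent boxes of a row). The box in row $i$ from the bottom and column $j$ from the left is denoted $[i,j]$. Let $N=(k+1)n$. Given a tiling $T$ of $\delta_N$, its path starts at $(n-1,0)$ and ends at $(0,N)$: from $(x,y)$ it takes a north step $N$ to $(x,y+1)$ if this does not cross a domino of $T$ and does not leave the diagram; otherwise it takes a west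 step $W$ to $(x-1,y)$. A north step is $NL$ if it is immediately preceded by a west step, and $NI$ otherwise. The Fuss-Catalan partial tiling $P$ associated with $T$ consists of the path together with the following tiles of $T$. In each row above the first (bottom) row: the tiles to the right of the north step in that row if it is $NL$, and the tiles to the left of it if it is $NI$. In the first row: no tiles, if the path begins with an $N$ step. If the path begins with $WN$ (so $T$ has a domino covering $[1,n-1]$ and $[1,n]$), let $m\ge 1$ be the smallest index such that $T$ has a domino covering $[1,mn-1],[1,mn]$ but no domino covering $[1,(m+1)n-1],[1,(m+1)n]$ (the box $[1,(k+1)n]$ is not in the diagram, so such $m\le k$ exists); then the tiles kept in the first row are those to the right of the $NL$ step except those in the boxes $[1,mn+1],\dots,[1,(m+1)n-1]$, which are left blank. All other boxes are blank. Different $T$ giving the same path and the same such tiles give the same Fuss-Catalan partial tiling, counted once. The weight is $\operatorname{wt}P=s^{\#\text{monominoes in }P}\,t^{\#\text{dominoes in }P}$. *)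

theory Defs
  imports
    "HOL-Computational_Algebra.Computational_Algebra"
    "HOL-Library.Disjoint_Sets"
begin

(* The ring \<int>[s, t] is modelled as \<int>[s][t] = int poly poly: the outer variable is t and the
   inner one is s. Quotients are taken in its field of fractions. *)

definition lucas_s :: "int poly poly" where
  "lucas_s = [:[:0, 1:]:]"

definition lucas_t :: "int poly poly" where
  "lucas_t = [:0, 1:]"

fun lucas :: "nat \<Rightarrow> int poly poly" where
  "lucas 0 = 0"
| "lucas (Suc 0) = 1"
| "lucas (Suc (Suc n)) = lucas_s * lucas (Suc n) + lucas_t * lucas n"

definition lucas_fact :: "nat \<Rightarrow> int poly poly" where
  "lucas_fact n = (\<Prod>i=1..n. lucas i)"

definition lucasnomial :: "nat \<Rightarrow> nat \<Rightarrow> int poly poly fract" where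
  "lucasnomial n k = to_fract (lucas_fact n) / (to_fract (lucas_fact k) * to_fract (lucas_fact (n - k)))"

definition lucas_fuss_catalan :: "nat \<Rightarrow> nat \<Rightarrow> int poly poly fract" where
  "lucas_fuss_catalan n k = 1 / to_fract (lucas (k * n + 1)) * lucasnomial ((k + 1) * n) n"

(* \<nat>[s, t] as a subset of the field of fractions *)
definition nat_polys :: "int poly poly fract set" where
  "nat_polys = {to_fract p | p. \<forall>i j. coeff (coeff p i) j \<in> \<nat>}"


(* The box [i, j] (row i from the bottom, column j from the left, both counted from 1) is the unit
   square with corners (j - 1, i - 1) and (j, i). *)

definition staircase :: "nat \<Rightarrow> (nat \<times> nat) set" where
  "staircase N = {(i, j). 1 \<le> i \<and> i < N \<and> 1 \<le> j \<and> j \<le> N - i}"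

(* Domino i j covers the boxes [i, j] and [i, j + 1]. *)
datatype tile = Monomino nat nat | Domino nat nat

fun boxes :: "tile \<Rightarrow> (nat \<times> nat) set" where
  "boxes (Monomino i j) = {(i, j)}"
| "boxes (Domino i j) = {(i, j), (i, Suc j)}"

fun tile_row :: "tile \<Rightarrow> nat" where
  "tile_row (Monomino i j) = i"
| "tile_row (Domino i j) = i"

definition is_tiling :: "nat \<Rightarrow> tile set \<Rightarrow> bool" where
  "is_tiling N T \<longleftrightarrow> disjoint_family_on boxes T \<and> (\<Union>\<tau>\<in>T. boxes \<tau>) = staircase N"


(* The step from (x, y) to (x, y + 1) lies in row y + 1. It stays in the diagram iff it lies on the
   border of that row, whose boxes occupy the abscissae 0, ..., N - (y + 1); in row N this is the
   extra unit segment from (0, N - 1) to (0, N). It crosses a domino iff it separates the two boxes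
   [y + 1, x] and [y + 1, x + 1] of that domino. *)
definition north_allowed :: "nat \<Rightarrow> tile set \<Rightarrow> nat \<Rightarrow> nat \<Rightarrow> bool" where
  "north_allowed N T x y \<longleftrightarrow> y < N \<and> x \<le> N - Suc y \<and> Domino (Suc y) x \<notin> T"

(* The list of lattice points visited from (x, y) on. For a tiling T of the staircase and
   x + y \<le> N, the last branch is reached exactly at (0, N): a north step with x = 0 and y < N is
   always allowed. *)
function path_from :: "nat \<Rightarrow> tile set \<Rightarrow> nat \<Rightarrow> nat \<Rightarrow> (nat \<times> nat) list" where
  "path_from N T x y = (x, y) #
     (if north_allowed N T x y then path_from N T x (Suc y)
      else if 0 < x then path_from N T (x - 1) y
      else [])"
  by auto
termination
  by (relation "measure (\<lambda>(N, T, x, y). x + (N - y))") (auto simp: north_allowed_def)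

declare path_from.simps [simp del]

(* For n = 0 the diagram degenerates to the origin and the nominal starting point (n - 1, 0) is read
   with truncated subtraction, so that the only path is the trivial one at (0, 0). *)
definition fc_path :: "nat \<Rightarrow> nat \<Rightarrow> tile set \<Rightarrow> (nat \<times> nat) list" where
  "fc_path n k T = path_from ((k + 1) * n) T (n - 1) 0"

definition north_step :: "(nat \<times> nat) list \<Rightarrow> nat \<Rightarrow> nat \<Rightarrow> nat \<Rightarrow> bool" where
  "north_step p i x y \<longleftrightarrow> Suc i < length p \<and> p ! i = (x, y) \<and> p ! Suc i = (x, Suc y)"

(* A north step that is not NL is NI. *)
definition NL_step :: "(nat \<times> nat) list \<Rightarrow> nat \<Rightarrow> nat \<Rightarrow> nat \<Rightarrow> bool" where
  "NL_step p i x y \<longleftrightarrow> north_step p i x y \<and> 0 < i \<and> p ! (i - 1) = (Suc x, y)"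

definition right_of :: "nat \<Rightarrow> tile \<Rightarrow> bool" where
  "right_of x \<tau> \<longleftrightarrow> (\<forall>(i, j)\<in>boxes \<tau>. x < j)"

definition left_of :: "nat \<Rightarrow> tile \<Rightarrow> bool" where
  "left_of x \<tau> \<longleftrightarrow> (\<forall>(i, j)\<in>boxes \<tau>. j \<le> x)"

(* Only meaningful if the path of T begins with WN, i.e. if T has a domino on [1, n - 1], [1, n]. *)
definition first_row_index :: "nat \<Rightarrow> tile set \<Rightarrow> nat" where
  "first_row_index n T =
     (LEAST m. 1 \<le> m \<and> Domino 1 (m * n - 1) \<in> T \<and> Domino 1 ((m + 1) * n - 1) \<notin> T)"

definition first_row_blank :: "nat \<Rightarrow> tile set \<Rightarrow> (nat \<times> nat) set" where
  "first_row_blank n T =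
     (let m = first_row_index n T in {1} \<times> {m * n + 1 .. (m + 1) * n - 1})"

(* The path begins with N iff the north step of the first row is NI, and with WN iff it is NL. *)
definition kept_tiles :: "nat \<Rightarrow> nat \<Rightarrow> tile set \<Rightarrow> tile set" where
  "kept_tiles n k T = {\<tau> \<in> T. \<exists>i x y.
     north_step (fc_path n k T) i x y \<and> tile_row \<tau> = Suc y \<and>
     (if y = 0
      then NL_step (fc_path n k T) i x y \<and> right_of x \<tau> \<and> \<not> boxes \<tau> \<subseteq> first_row_blank n T
      else if NL_step (fc_path n k T) i x y then right_of x \<tau>
      else left_of x \<tau>)}"

definition fc_partial_tiling :: "nat \<Rightarrow> nat \<Rightarrow> tile set \<Rightarrow> (nat \<times> nat) list \<times> tile set" where
  "fc_partial_tiling n k T = (fc_path n k T, kept_tiles n k T)"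

definition fc_partial_tilings :: "nat \<Rightarrow> nat \<Rightarrow> ((nat \<times> nat) list \<times> tile set) set" where
  "fc_partial_tilings n k = fc_partial_tiling n k ` {T. is_tiling ((k + 1) * n) T}"

definition wt :: "(nat \<times> nat) list \<times> tile set \<Rightarrow> int poly poly" where
  "wt P = lucas_s ^ card {\<tau> \<in> snd P. \<exists>i j. \<tau> = Monomino i j} *
          lucas_t ^ card {\<tau> \<in> snd P. \<exists>i j. \<tau> = Domino i j}"

end

theory Submission
  imports Defs
begin

text \<open>
  The rows of the staircase can be tiled independently, and the tilings of a row with \<open>l\<close> boxes have total
  weight \<open>{l + 1}\<close> (\<open>gf_seg\<close>). So the partial tilings can be summed row by row along their paths.

  In a row above the first one, a path standing at abscissa \<open>x\<close> with \<open>h\<close> steps north still to go either climbs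
  at once, keeping a tiling of the \<open>x\<close> boxes on its left, or makes exactly one west step before it climbs,
  keeping the domino that was in its way and a tiling of the boxes to the right of that domino (or nothing, if
  the border of the diagram was in its way). The weighted sum therefore satisfies
  \<open>Z(x, h) = {x + 1} Z(x, h - 1) + t {h - x - 1} Z(x - 1, h - 1)\<close> for \<open>x < h\<close> and \<open>Z(h, h) = Z(h - 1, h - 1)\<close>; the solution is the
  Lucas analogue of the binomial coefficient \<open>h\<close> over \<open>x\<close> (\<open>sum_wt_outcomes\<close>).

  In the first row, a path that climbs at once keeps nothing. For the others, let \<open>R\<close> be the total weight of
  the tiles kept there. Each time the row continues with another domino at the end of a block of \<open>n\<close> boxes, the
  weight gains a factor \<open>t {n - 1}\<close>; at the first block without such a domino, that block becomes blank up to its last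
  box, and the rest of the row is free. This recursion matches the one that the addition formula gives for \<open>{k n} / {n}\<close>, so that \<open>{n} R = t {k n}\<close>
  (\<open>gf_block_kept\<close>, \<open>gf_first_row_kept\<close>).

  With \<open>N = (k + 1) n\<close> the total is \<open>Z(n - 1, N - 1) + R Z(n - 2, N - 1)\<close>, and the identity
  \<open>{N} = {n} {k n + 1} + t {n - 1} {k n}\<close> turns it into the Lucas analogue of the Fuss-Catalan number. Every weight is a
  monomial in \<open>s\<close> and \<open>t\<close>, so the coefficients of the sum are natural numbers.

  To avoid division, each identity is proved in the ring of polynomials after multiplication by the
  denominators, and quotients appear only in the last step.
\<close>

section \<open>Lucas polynomials\<close>

text \<open>Both summands count tilings of a row of \<open>m + n\<close> boxes: those that can be cut after box \<open>m\<close>, and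
those with a domino on boxes \<open>m\<close>, \<open>m + 1\<close>. The identities between Lucas polynomials needed below all come from this one.\<close>

lemma lucas_add:
  "lucas (Suc (m + n)) = lucas (Suc m) * lucas (Suc n) + lucas_t * lucas m * lucas n"
proof (induction n arbitrary: m)
  case 0
  show ?case by simp
next
  case (Suc n)
  have "lucas (Suc (m + Suc n)) = lucas (Suc (Suc m + n))" by simp
  also have "\<dots> = lucas (Suc (Suc m)) * lucas (Suc n) + lucas_t * lucas (Suc m) * lucas n"
    by (rule Suc)
  also have "\<dots> = lucas (Suc m) * lucas (Suc (Suc n)) + lucas_t * lucas m * lucas (Suc n)"
    by (simp add: algebra_simps)
  finally show ?case .
qed

text \<open>At \<open>s = t = 1\<close> the sequence consists of the Fibonacci numbers, which are positive.\<close>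

lemma lucas_neq_0: "lucas (Suc n) \<noteq> 0"
proof -
  have "poly (poly (lucas (Suc n)) 1) 1 > 0 \<and> poly (poly (lucas n) 1) 1 \<ge> 0"
    by (induction n) (auto simp: lucas_s_def lucas_t_def)
  thus ?thesis by auto
qed

lemma lucas_fact_Suc: "lucas_fact (Suc n) = lucas (Suc n) * lucas_fact n"
  by (simp add: lucas_fact_def mult.commute)

lemma lucas_fact_0 [simp]: "lucas_fact 0 = 1"
  by (simp add: lucas_fact_def)

lemma lucas_fact_neq_0: "lucas_fact n \<noteq> 0"
  by (induction n) (auto simp: lucas_fact_Suc lucas_neq_0)

section \<open>Tilings of regions and their generating functions\<close>

definition tilings :: "(nat \<times> nat) set \<Rightarrow> tile set set" where
  "tilings R = {T. disjoint_family_on boxes T \<and> (\<Union>\<tau>\<in>T. boxes \<tau>) = R}"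

fun tile_weight :: "tile \<Rightarrow> int poly poly" where
  "tile_weight (Monomino i j) = lucas_s"
| "tile_weight (Domino i j) = lucas_t"

definition weight :: "tile set \<Rightarrow> int poly poly" where
  "weight K = (\<Prod>\<tau>\<in>K. tile_weight \<tau>)"

definition gf :: "tile set set \<Rightarrow> int poly poly" where
  "gf F = (\<Sum>K\<in>F. weight K)"

definition unions :: "tile set set \<Rightarrow> tile set set \<Rightarrow> tile set set" where
  "unions F G = (\<lambda>(K, L). K \<union> L) ` (F \<times> G)"

definition inside :: "(nat \<times> nat) set \<Rightarrow> tile set \<Rightarrow> bool" where
  "inside R K \<longleftrightarrow> finite K \<and> (\<forall>\<tau>\<in>K. boxes \<tau> \<subseteq> R)"

lemma boxes_nonempty [simp]: "boxes \<tau> \<noteq> {}"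
  by (cases \<tau>) auto

lemma weight_empty [simp]: "weight {} = 1"
  by (simp add: weight_def)

lemma weight_singleton [simp]: "weight {\<tau>} = tile_weight \<tau>"
  by (simp add: weight_def)

lemma gf_singleton [simp]: "gf {K} = weight K"
  by (simp add: gf_def)

lemma wt_eq_weight:
  assumes "finite K"
  shows "wt (p, K) = weight K"
proof -
  let ?M = "{\<tau> \<in> K. \<exists>i j. \<tau> = Monomino i j}" and ?D = "{\<tau> \<in> K. \<exists>i j. \<tau> = Domino i j}"
  have K: "K = ?M \<union> ?D"
    by (auto intro: tile.exhaust)
  have "weight K = (\<Prod>\<tau>\<in>?M. tile_weight \<tau>) * (\<Prod>\<tau>\<in>?D. tile_weight \<tau>)"
    unfolding weight_def by (subst K, rule prod.union_disjoint) (use assms in auto)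
  also have "(\<Prod>\<tau>\<in>?M. tile_weight \<tau>) = (\<Prod>\<tau>\<in>?M. lucas_s)"
    by (rule prod.cong) auto
  also have "(\<Prod>\<tau>\<in>?D. tile_weight \<tau>) = (\<Prod>\<tau>\<in>?D. lucas_t)"
    by (rule prod.cong) auto
  finally show ?thesis by (simp add: wt_def)
qed

lemma inside_union_left:
  assumes "inside A K" "inside B L" "A \<inter> B = {}"
  shows "{\<tau> \<in> K \<union> L. boxes \<tau> \<subseteq> A} = K"
proof -
  have "\<not> boxes \<tau> \<subseteq> A" if "\<tau> \<in> L" for \<tau>
  proof -
    have "boxes \<tau> \<subseteq> B" using assms that by (auto simp: inside_def)
    thus ?thesis using assms(3) boxes_nonempty[of \<tau>] by blast
  qed
  thus ?thesis using assms(1) by (auto simp: inside_def)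
qed

text \<open>A union of tile sets living in disjoint regions determines its two parts. This is what makes counting
distinct partial tilings the same as multiplying generating functions.\<close>

lemma inside_union_eqD:
  assumes "inside A K" "inside B L" "inside A K'" "inside B L'" "A \<inter> B = {}" "K \<union> L = K' \<union> L'"
  shows "K = K'" "L = L'"
proof -
  have BA: "B \<inter> A = {}" using assms(5) by auto
  show "K = K'"
    using inside_union_left[OF assms(1,2,5)] inside_union_left[OF assms(3,4,5)] assms(6) by simp
  show "L = L'"
    using inside_union_left[OF assms(2,1) BA] inside_union_left[OF assms(4,3) BA] assms(6)
    by (simp add: Un_commute)
qed

lemma weight_union:
  assumes "inside A K" "inside B L" "A \<inter> B = {}"
  shows "weight (K \<union> L) = weight K * weight L"
proof -
  have "K \<inter> L = {}"
  proof (rule ccontr)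
    assume "K \<inter> L \<noteq> {}"
    then obtain \<tau> where "\<tau> \<in> K" "\<tau> \<in> L" by auto
    hence "boxes \<tau> \<subseteq> A \<inter> B" using assms(1,2) by (auto simp: inside_def)
    thus False using assms(3) by simp
  qed
  thus ?thesis using assms unfolding weight_def inside_def
    by (simp add: prod.union_disjoint)
qed

lemma gf_unions:
  assumes "\<And>K. K \<in> F \<Longrightarrow> inside A K" "\<And>L. L \<in> G \<Longrightarrow> inside B L" "A \<inter> B = {}"
  shows "gf (unions F G) = gf F * gf G"
proof -
  have inj: "inj_on (\<lambda>(K, L). K \<union> L) (F \<times> G)"
    using inside_union_eqD[OF assms(1) assms(2) assms(1) assms(2) assms(3)]
    by (fastforce simp: inj_on_def)
  have "gf (unions F G) = (\<Sum>(K, L)\<in>F \<times> G. weight (K \<union> L))"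
    unfolding gf_def unions_def by (subst sum.reindex[OF inj]) (simp add: o_def case_prod_unfold)
  also have "\<dots> = (\<Sum>(K, L)\<in>F \<times> G. weight K * weight L)"
    by (rule sum.cong) (auto intro: weight_union[OF assms(1) assms(2) assms(3)])
  also have "\<dots> = gf F * gf G"
    by (simp add: gf_def sum_product sum.cartesian_product)
  finally show ?thesis .
qed

lemma tilings_boxes: "T \<in> tilings R \<Longrightarrow> \<tau> \<in> T \<Longrightarrow> boxes \<tau> \<subseteq> R"
  by (auto simp: tilings_def)

lemma tilings_cover: "T \<in> tilings R \<Longrightarrow> b \<in> R \<Longrightarrow> \<exists>\<tau>\<in>T. b \<in> boxes \<tau>"
  by (auto simp: tilings_def)

lemma tilings_unique:
  "T \<in> tilings R \<Longrightarrow> \<tau> \<in> T \<Longrightarrow> \<sigma> \<in> T \<Longrightarrow> b \<in> boxes \<tau> \<Longrightarrow> b \<in> boxes \<sigma> \<Longrightarrow> \<tau> = \<sigma>"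
  unfolding tilings_def disjoint_family_on_def by blast

lemma tilingsI:
  assumes "\<And>\<tau>. \<tau> \<in> T \<Longrightarrow> boxes \<tau> \<subseteq> R" "\<And>b. b \<in> R \<Longrightarrow> \<exists>\<tau>\<in>T. b \<in> boxes \<tau>"
    "\<And>\<tau> \<sigma> b. \<tau> \<in> T \<Longrightarrow> \<sigma> \<in> T \<Longrightarrow> b \<in> boxes \<tau> \<Longrightarrow> b \<in> boxes \<sigma> \<Longrightarrow> \<tau> = \<sigma>"
  shows "T \<in> tilings R"
proof -
  have "disjoint_family_on boxes T"
    unfolding disjoint_family_on_def using assms(3) by (meson disjoint_iff)
  moreover have "(\<Union>\<tau>\<in>T. boxes \<tau>) = R"
    using assms(1,2) by (meson UN_iff equalityI subsetI subset_iff)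
  ultimately show ?thesis by (simp add: tilings_def)
qed

lemma finite_tiles_in:
  assumes "finite R"
  shows "finite {\<tau>. boxes \<tau> \<subseteq> R}"
proof (rule finite_subset)
  show "{\<tau>. boxes \<tau> \<subseteq> R} \<subseteq> (\<lambda>(i, j). Monomino i j) ` R \<union> (\<lambda>(i, j). Domino i j) ` R"
  proof
    fix \<tau> assume "\<tau> \<in> {\<tau>. boxes \<tau> \<subseteq> R}"
    thus "\<tau> \<in> (\<lambda>(i, j). Monomino i j) ` R \<union> (\<lambda>(i, j). Domino i j) ` R"
      by (cases \<tau>) force+
  qed
qed (use assms in auto)

lemma finite_tilings:
  assumes "finite R"
  shows "finite (tilings R)"
proof (rule finite_subset)
  show "tilings R \<subseteq> Pow {\<tau>. boxes \<tau> \<subseteq> R}" by (auto simp: tilings_def)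
qed (use finite_tiles_in[OF assms] in auto)

lemma inside_tilings:
  assumes "finite R" "T \<in> tilings R"
  shows "inside R T"
  unfolding inside_def
proof
  show "finite T"
    by (rule finite_subset[OF _ finite_tiles_in[OF assms(1)]])
      (use tilings_boxes[OF assms(2)] in auto)
qed (use tilings_boxes[OF assms(2)] in auto)

lemma tilings_nonempty: "tilings R \<noteq> {}"
proof -
  have "(\<lambda>(i, j). Monomino i j) ` R \<in> tilings R"
    unfolding tilings_def disjoint_family_on_def by auto
  thus ?thesis by blast
qed

lemma tilings_empty [simp]: "tilings {} = {{}}"
proof -
  have "T = {}" if "T \<in> tilings {}" for T
  proof (rule equals0I)
    fix \<tau> assume "\<tau> \<in> T"
    thus False using tilings_boxes[OF that] boxes_nonempty[of \<tau>] by blast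
  qed
  thus ?thesis using tilings_nonempty[of "{}"] by blast
qed

lemma tilings_Un:
  assumes "K \<in> tilings A" "L \<in> tilings B" "A \<inter> B = {}"
  shows "K \<union> L \<in> tilings (A \<union> B)"
proof (rule tilingsI)
  fix \<tau> \<sigma> b
  assume *: "\<tau> \<in> K \<union> L" "\<sigma> \<in> K \<union> L" "b \<in> boxes \<tau>" "b \<in> boxes \<sigma>"
  have in_K: "b \<in> A" if "\<rho> \<in> K" "b \<in> boxes \<rho>" for \<rho>
    using tilings_boxes[OF assms(1) that(1)] that(2) by auto
  have in_L: "b \<in> B" if "\<rho> \<in> L" "b \<in> boxes \<rho>" for \<rho>
    using tilings_boxes[OF assms(2) that(1)] that(2) by auto
  have "\<not> (b \<in> A \<and> b \<in> B)" using assms(3) by auto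
  hence "(\<tau> \<in> K \<and> \<sigma> \<in> K) \<or> (\<tau> \<in> L \<and> \<sigma> \<in> L)"
    using * in_K in_L by (metis Un_iff)
  thus "\<tau> = \<sigma>"
    using tilings_unique[OF assms(1) _ _ *(3,4)] tilings_unique[OF assms(2) _ _ *(3,4)] by auto
next
  show "\<And>\<tau>. \<tau> \<in> K \<union> L \<Longrightarrow> boxes \<tau> \<subseteq> A \<union> B"
    using tilings_boxes[OF assms(1)] tilings_boxes[OF assms(2)] by auto
next
  show "\<And>b. b \<in> A \<union> B \<Longrightarrow> \<exists>\<tau>\<in>K \<union> L. b \<in> boxes \<tau>"
    using tilings_cover[OF assms(1)] tilings_cover[OF assms(2)] by (metis Un_iff)
qed

lemma tilings_restrict:
  assumes "T \<in> tilings R" "A \<subseteq> R" "\<And>\<tau>. \<tau> \<in> T \<Longrightarrow> boxes \<tau> \<subseteq> A \<or> boxes \<tau> \<inter> A = {}"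
  shows "{\<tau> \<in> T. boxes \<tau> \<subseteq> A} \<in> tilings A"
proof (rule tilingsI)
  fix b assume b: "b \<in> A"
  then obtain \<tau> where "\<tau> \<in> T" "b \<in> boxes \<tau>"
    using tilings_cover[OF assms(1)] assms(2) by blast
  thus "\<exists>\<tau>\<in>{\<tau> \<in> T. boxes \<tau> \<subseteq> A}. b \<in> boxes \<tau>"
    using assms(3)[of \<tau>] b by blast
next
  fix \<tau> \<sigma> b
  assume "\<tau> \<in> {\<tau> \<in> T. boxes \<tau> \<subseteq> A}" "\<sigma> \<in> {\<tau> \<in> T. boxes \<tau> \<subseteq> A}" "b \<in> boxes \<tau>" "b \<in> boxes \<sigma>"
  thus "\<tau> = \<sigma>" using tilings_unique[OF assms(1), of \<tau> \<sigma> b] by simp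
qed simp

text \<open>Tiles that straddle two regions are the only obstruction to tiling them independently.\<close>

lemma tilings_split:
  assumes "A \<inter> B = {}"
  shows "{T \<in> tilings (A \<union> B). \<forall>\<tau>\<in>T. boxes \<tau> \<subseteq> A \<or> boxes \<tau> \<subseteq> B} = unions (tilings A) (tilings B)"
    (is "?L = ?R")
proof
  show "?R \<subseteq> ?L"
    using tilings_Un[OF _ _ assms] tilings_boxes by (fastforce simp: unions_def)
  show "?L \<subseteq> ?R"
  proof
    fix T assume T: "T \<in> ?L"
    let ?K = "{\<tau> \<in> T. boxes \<tau> \<subseteq> A}" and ?M = "{\<tau> \<in> T. boxes \<tau> \<subseteq> B}"
    have "?K \<in> tilings A" "?M \<in> tilings B"
      by (rule tilings_restrict[of _ "A \<union> B"]; use T assms in blast)+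
    moreover have "T = ?K \<union> ?M" using T by blast
    ultimately show "T \<in> ?R" unfolding unions_def by blast
  qed
qed

lemma tilings_domino: "tilings {(r, x), (r, Suc x)} \<inter> {T. Domino r x \<in> T} = {{Domino r x}}"
proof -
  have "T = {Domino r x}" if T: "T \<in> tilings {(r, x), (r, Suc x)}" "Domino r x \<in> T" for T
  proof -
    have "\<tau> = Domino r x" if "\<tau> \<in> T" for \<tau>
    proof -
      obtain b where "b \<in> boxes \<tau>" using boxes_nonempty by blast
      moreover have "b \<in> boxes (Domino r x)"
        using tilings_boxes[OF T(1) that] calculation by auto
      ultimately show ?thesis using tilings_unique[OF T(1) that T(2)] by blast
    qed
    thus ?thesis using T(2) by blast
  qed
  moreover have "{Domino r x} \<in> tilings {(r, x), (r, Suc x)}"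
    by (rule tilingsI) auto
  ultimately show ?thesis by blast
qed

section \<open>Tilings of row segments\<close>

definition seg :: "nat \<Rightarrow> nat \<Rightarrow> nat \<Rightarrow> (nat \<times> nat) set" where
  "seg r a b = {r} \<times> {a..<b}"

lemma finite_seg [simp]: "finite (seg r a b)"
  by (simp add: seg_def)

lemma seg_empty [simp]: "seg r a a = {}"
  by (simp add: seg_def)

lemma in_seg [simp]: "(i, j) \<in> seg r a b \<longleftrightarrow> i = r \<and> a \<le> j \<and> j < b"
  by (auto simp: seg_def)

lemma seg_disjoint: "b \<le> c \<Longrightarrow> seg r a b \<inter> seg r c d = {}"
  by (auto simp: seg_def)

lemma inside_seg: "T \<in> tilings (seg r a b) \<Longrightarrow> inside (seg r a b) T"
  by (rule inside_tilings) auto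

text \<open>The vertical line at abscissa \<open>x\<close> separates the boxes \<open>x\<close> and \<open>x + 1\<close>, so the domino on these two
boxes is the only tile that can cross it.\<close>

lemma tilings_seg_without_domino:
  assumes "a \<le> Suc x" "Suc x \<le> b"
  shows "{K \<in> tilings (seg r a b). Domino r x \<notin> K} =
    unions (tilings (seg r a (Suc x))) (tilings (seg r (Suc x) b))"
proof -
  let ?A = "seg r a (Suc x)" and ?B = "seg r (Suc x) b"
  have disj: "?A \<inter> ?B = {}" by (auto simp: seg_def)
  have un: "seg r a b = ?A \<union> ?B" using assms by (auto simp: seg_def)
  have crossing: "boxes \<tau> \<subseteq> ?A \<or> boxes \<tau> \<subseteq> ?B \<longleftrightarrow> \<tau> \<noteq> Domino r x" if "boxes \<tau> \<subseteq> seg r a b" for \<tau>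
    using that by (cases \<tau>) auto
  have "{K \<in> tilings (seg r a b). Domino r x \<notin> K} =
     {T \<in> tilings (?A \<union> ?B). \<forall>\<tau>\<in>T. boxes \<tau> \<subseteq> ?A \<or> boxes \<tau> \<subseteq> ?B}"
    unfolding un[symmetric] using crossing tilings_boxes by blast
  thus ?thesis by (simp only: tilings_split[OF disj])
qed

text \<open>A domino walls off the parts of the row on its two sides from each other.\<close>

lemma tilings_seg_with_domino:
  assumes "a \<le> x" "Suc (Suc x) \<le> b"
  shows "{K \<in> tilings (seg r a b). Domino r x \<in> K} =
    unions (tilings (seg r a x)) (unions {{Domino r x}} (tilings (seg r (Suc (Suc x)) b)))"
    (is "?L = ?R")
proof
  let ?A = "seg r a x" and ?D = "{(r, x), (r, Suc x)}" and ?B = "seg r (Suc (Suc x)) b"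
  have un: "seg r a b = ?A \<union> (?D \<union> ?B)" using assms by (auto simp: seg_def)
  have disj: "?A \<inter> (?D \<union> ?B) = {}" "?D \<inter> ?B = {}" by (auto simp: seg_def)
  have D: "{Domino r x} \<in> tilings ?D" using tilings_domino by blast
  show "?R \<subseteq> ?L"
  proof
    fix K assume "K \<in> ?R"
    then obtain A B where AB: "A \<in> tilings ?A" "B \<in> tilings ?B" "K = A \<union> ({Domino r x} \<union> B)"
      by (auto simp: unions_def)
    show "K \<in> ?L"
      using tilings_Un[OF AB(1) tilings_Un[OF D AB(2) disj(2)] disj(1)] AB(3) un by simp
  qed
  show "?L \<subseteq> ?R"
  proof
    fix K assume K: "K \<in> ?L"
    hence Kt: "K \<in> tilings (?A \<union> (?D \<union> ?B))" and DK: "Domino r x \<in> K" using un by auto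
    have sep: "\<tau> = Domino r x \<or> boxes \<tau> \<subseteq> ?A \<or> boxes \<tau> \<subseteq> ?B" if "\<tau> \<in> K" for \<tau>
    proof (cases "\<tau> = Domino r x")
      case False
      hence "(r, x) \<notin> boxes \<tau>" "(r, Suc x) \<notin> boxes \<tau>"
        using tilings_unique[OF Kt that DK] by auto
      thus ?thesis using tilings_boxes[OF Kt that] by (cases \<tau>) auto
    qed simp
    have "\<forall>\<tau>\<in>K. boxes \<tau> \<subseteq> ?A \<or> boxes \<tau> \<subseteq> ?D \<union> ?B" using sep by fastforce
    hence "K \<in> unions (tilings ?A) (tilings (?D \<union> ?B))" using tilings_split[OF disj(1)] Kt by blast
    then obtain A M where AM: "A \<in> tilings ?A" "M \<in> tilings (?D \<union> ?B)" "K = A \<union> M"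
      by (auto simp: unions_def)
    have "\<forall>\<tau>\<in>M. boxes \<tau> \<subseteq> ?D \<or> boxes \<tau> \<subseteq> ?B"
    proof
      fix \<tau> assume \<tau>: "\<tau> \<in> M"
      have "\<not> boxes \<tau> \<subseteq> ?A" using tilings_boxes[OF AM(2) \<tau>] disj(1) boxes_nonempty[of \<tau>] by blast
      thus "boxes \<tau> \<subseteq> ?D \<or> boxes \<tau> \<subseteq> ?B" using sep[of \<tau>] \<tau> AM(3) by auto
    qed
    hence "M \<in> unions (tilings ?D) (tilings ?B)" using tilings_split[OF disj(2)] AM(2) by blast
    then obtain E B where EB: "E \<in> tilings ?D" "B \<in> tilings ?B" "M = E \<union> B"
      by (auto simp: unions_def)
    have "Domino r x \<notin> A" "Domino r x \<notin> B"
      using tilings_boxes[OF AM(1)] tilings_boxes[OF EB(2)] by fastforce+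
    hence "Domino r x \<in> E" using EB(3) AM(3) DK by simp
    hence "E \<in> {{Domino r x}}" unfolding tilings_domino[symmetric] using EB(1) by simp
    hence "K = A \<union> ({Domino r x} \<union> B)" using AM(3) EB(3) by simp
    thus "K \<in> ?R" using AM(1) EB(2) unfolding unions_def by blast
  qed
qed

lemma gf_Un_disjoint:
  assumes "finite F" "finite G" "F \<inter> G = {}"
  shows "gf (F \<union> G) = gf F + gf G"
  unfolding gf_def by (rule sum.union_disjoint) (use assms in auto)

lemma tilings_seg_single: "tilings (seg r a (Suc a)) = {{Monomino r a}}"
proof -
  have "T = {Monomino r a}" if T: "T \<in> tilings (seg r a (Suc a))" for T
  proof -
    have "\<tau> = Monomino r a" if "\<tau> \<in> T" for \<tau>
      using tilings_boxes[OF T that] by (cases \<tau>) auto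
    moreover have "\<exists>\<tau>. \<tau> \<in> T" using tilings_cover[OF T, of "(r, a)"] by auto
    ultimately show ?thesis by blast
  qed
  thus ?thesis using tilings_nonempty[of "seg r a (Suc a)"] by blast
qed

lemma gf_unions_domino:
  assumes "\<And>L. L \<in> G \<Longrightarrow> inside (seg r (Suc (Suc x)) b) L"
  shows "gf (unions {{Domino r x}} G) = lucas_t * gf G"
proof -
  have "inside (seg r x (Suc (Suc x))) K" if "K \<in> {{Domino r x}}" for K
    using that by (auto simp: inside_def)
  hence "gf (unions {{Domino r x}} G) = gf {{Domino r x}} * gf G"
    by (rule gf_unions[OF _ assms seg_disjoint]) auto
  thus ?thesis by simp
qed

lemma inside_unions_domino:
  assumes "\<And>L. L \<in> G \<Longrightarrow> inside (seg r (Suc (Suc x)) b) L" "Suc (Suc x) \<le> b"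
    and "K \<in> unions {{Domino r x}} G"
  shows "inside (seg r x b) K"
  using assms by (fastforce simp: unions_def inside_def)

lemma gf_seg_with_domino:
  assumes "Suc (Suc x) \<le> b" "\<And>L. L \<in> G \<Longrightarrow> inside (seg r (Suc (Suc x)) b) L"
  shows "gf (unions (tilings (seg r a x)) (unions {{Domino r x}} G)) =
    gf (tilings (seg r a x)) * (lucas_t * gf G)"
proof -
  have "gf (unions (tilings (seg r a x)) (unions {{Domino r x}} G)) =
      gf (tilings (seg r a x)) * gf (unions {{Domino r x}} G)"
    by (rule gf_unions[OF inside_seg inside_unions_domino[OF assms(2,1)] seg_disjoint]) auto
  thus ?thesis by (simp add: gf_unions_domino[OF assms(2)])
qed

text \<open>Distinguishing the two possible leftmost tiles gives the recursion of the Lucas polynomials.\<close>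

lemma gf_seg: "gf (tilings (seg r a (a + l))) = lucas (Suc l)"
proof (induction l arbitrary: a rule: lucas.induct)
  case 1
  show ?case by simp
next
  case 2
  show ?case by (simp add: tilings_seg_single)
next
  case (3 l)
  let ?b = "a + Suc (Suc l)" and ?D = "Domino r a"
  have split: "tilings (seg r a ?b) =
      {K \<in> tilings (seg r a ?b). ?D \<notin> K} \<union> {K \<in> tilings (seg r a ?b). ?D \<in> K}"
    by blast
  have "gf (tilings (seg r a ?b)) =
      gf {K \<in> tilings (seg r a ?b). ?D \<notin> K} + gf {K \<in> tilings (seg r a ?b). ?D \<in> K}"
    by (subst split, rule gf_Un_disjoint) (auto simp: finite_tilings)
  also have "gf {K \<in> tilings (seg r a ?b). ?D \<notin> K} =
      gf (unions (tilings (seg r a (Suc a))) (tilings (seg r (Suc a) ?b)))"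
    by (subst tilings_seg_without_domino) auto
  also have "\<dots> = gf (tilings (seg r a (Suc a))) * gf (tilings (seg r (Suc a) ?b))"
    by (rule gf_unions[OF inside_seg inside_seg seg_disjoint]) auto
  also have "\<dots> = lucas_s * gf (tilings (seg r (Suc a) (Suc a + Suc l)))"
    by (simp add: tilings_seg_single)
  also have "gf {K \<in> tilings (seg r a ?b). ?D \<in> K} =
      gf (unions (tilings (seg r a a)) (unions {{?D}} (tilings (seg r (Suc (Suc a)) ?b))))"
    by (subst tilings_seg_with_domino) auto
  also have "\<dots> = gf (tilings (seg r a a)) * (lucas_t * gf (tilings (seg r (Suc (Suc a)) ?b)))"
    by (rule gf_seg_with_domino[OF _ inside_seg]) auto
  finally show ?case using 3(1)[of "Suc a"] 3(2)[of "Suc (Suc a)"] by simp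
qed

section \<open>Row-wise decomposition of partial tilings\<close>

text \<open>The rows of the staircase that a path standing at height \<open>y\<close> has not yet climbed.\<close>

definition upper :: "nat \<Rightarrow> nat \<Rightarrow> (nat \<times> nat) set" where
  "upper N y = {(i, j). y < i \<and> i < N \<and> 1 \<le> j \<and> j \<le> N - i}"

lemma finite_upper [simp]: "finite (upper N y)"
  by (rule finite_subset[of _ "{..N} \<times> {..N}"]) (auto simp: upper_def)

lemma is_tiling_iff: "is_tiling N T \<longleftrightarrow> T \<in> tilings (upper N 0)"
proof -
  have "staircase N = upper N 0" by (auto simp: staircase_def upper_def)
  thus ?thesis by (simp add: is_tiling_def tilings_def)
qed

lemma seg_upper_disjoint: "seg (Suc y) a b \<inter> upper N (Suc y) = {}"
  by (auto simp: upper_def seg_def)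

lemma tilings_upper:
  assumes "y < N"
  shows "tilings (upper N y) = unions (tilings (seg (Suc y) 1 (N - y))) (tilings (upper N (Suc y)))"
proof -
  let ?A = "seg (Suc y) 1 (N - y)" and ?B = "upper N (Suc y)"
  have un: "upper N y = ?A \<union> ?B" using assms by (auto simp: seg_def upper_def)
  have one_row: "boxes \<tau> \<subseteq> ?A \<or> boxes \<tau> \<subseteq> ?B" if "boxes \<tau> \<subseteq> upper N y" for \<tau>
    using that by (cases \<tau>) (auto simp: upper_def)
  have "tilings (upper N y) = {T \<in> tilings (?A \<union> ?B). \<forall>\<tau>\<in>T. boxes \<tau> \<subseteq> ?A \<or> boxes \<tau> \<subseteq> ?B}"
    unfolding un[symmetric] using one_row tilings_boxes by blast
  thus ?thesis by (simp only: tilings_split[OF seg_upper_disjoint])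
qed

lemma path_from_Cons: "\<exists>p. path_from N T x y = (x, y) # p"
  by (subst path_from.simps) blast

lemma path_from_rows: "(a, b) \<in> set (path_from N T x y) \<Longrightarrow> y \<le> b"
proof (induction N T x y arbitrary: a b rule: path_from.induct)
  case (1 N T x y)
  from 1(3) show ?case
    by (subst (asm) path_from.simps) (use 1(1,2) in \<open>auto split: if_splits dest: Suc_leD\<close>)
qed

lemma path_from_cong:
  assumes "\<And>i j. y < i \<Longrightarrow> Domino i j \<in> T \<longleftrightarrow> Domino i j \<in> T'"
  shows "path_from N T x y = path_from N T' x y"
  using assms
proof (induction N T x y rule: path_from.induct)
  case (1 N T x y)
  have na: "north_allowed N T x y = north_allowed N T' x y"
    using 1(3) by (simp add: north_allowed_def)
  show ?case
    by (subst (1 2) path_from.simps) (use 1 na in auto)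
qed

lemma path_from_north:
  assumes "north_allowed N T x y"
  shows "path_from N T x y = (x, y) # path_from N T x (Suc y)"
  using assms by (subst path_from.simps) simp

lemma path_from_west:
  assumes "\<not> north_allowed N T (Suc x) y"
  shows "path_from N T (Suc x) y = (Suc x, y) # path_from N T x y"
  using assms by (subst path_from.simps) simp

text \<open>The rule for keeping a tile is a parameter because the bottom row follows a different rule from the
others; its arguments are the type of the north step (true for NL), the position of that step, and
the tile.\<close>

definition select ::
    "(bool \<Rightarrow> nat \<Rightarrow> nat \<Rightarrow> tile \<Rightarrow> bool) \<Rightarrow> (nat \<times> nat) list \<Rightarrow> tile set \<Rightarrow> tile set" where
  "select Q p T = {\<tau> \<in> T. \<exists>i x y.
     north_step p i x y \<and> tile_row \<tau> = Suc y \<and> Q (NL_step p i x y) x y \<tau>}"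

lemma north_step_Cons_0: "north_step (a # q) 0 x y \<longleftrightarrow> q \<noteq> [] \<and> a = (x, y) \<and> hd q = (x, Suc y)"
  by (cases q) (auto simp: north_step_def)

lemma north_step_Cons_Suc: "north_step (a # q) (Suc i) x y \<longleftrightarrow> north_step q i x y"
  by (auto simp: north_step_def)

lemma NL_step_Cons_0: "\<not> NL_step p 0 x y"
  by (simp add: NL_step_def)

lemma NL_step_Cons_1:
  "NL_step (a # q) (Suc 0) x y \<longleftrightarrow> north_step q 0 x y \<and> a = (Suc x, y)"
  by (simp add: NL_step_def north_step_Cons_Suc)

lemma NL_step_Cons_Suc_Suc:
  "NL_step (a # q) (Suc (Suc i)) x y \<longleftrightarrow> NL_step q (Suc i) x y"
  by (simp add: NL_step_def north_step_Cons_Suc)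

lemma select_Cons:
  "select Q (a # q) T = {\<tau> \<in> T. \<exists>x y. north_step (a # q) 0 x y \<and> tile_row \<tau> = Suc y \<and> Q False x y \<tau>}
     \<union> {\<tau> \<in> T. \<exists>i x y. north_step q i x y \<and> tile_row \<tau> = Suc y \<and> Q (NL_step (a # q) (Suc i) x y) x y \<tau>}"
proof -
  have ex_nat: "(\<exists>i. P i) \<longleftrightarrow> P 0 \<or> (\<exists>i. P (Suc i))" for P :: "nat \<Rightarrow> bool"
    by (metis not0_implies_Suc)
  show ?thesis
    unfolding select_def by (subst ex_nat) (auto simp: NL_step_Cons_0 north_step_Cons_Suc)
qed

text \<open>Cutting off the first vertex leaves the types of all later north steps unchanged: a path entering
the height \<open>Suc y\<close> from below has no west step immediately before its next north step.\<close>

lemma select_north: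
  "select Q ((x, y) # (x, Suc y) # q) T =
     {\<tau> \<in> T. tile_row \<tau> = Suc y \<and> Q False x y \<tau>} \<union> select Q ((x, Suc y) # q) T"
proof -
  have "NL_step ((x, y) # (x, Suc y) # q) (Suc i) x' y' \<longleftrightarrow> NL_step ((x, Suc y) # q) i x' y'" for i x' y'
    by (cases i) (auto simp: NL_step_Cons_0 NL_step_Cons_1 NL_step_Cons_Suc_Suc north_step_Cons_0)
  thus ?thesis
    by (subst select_Cons) (auto simp: north_step_Cons_0 select_def)
qed

lemma select_west_north:
  "select Q ((Suc x, y) # (x, y) # (x, Suc y) # q) T =
     {\<tau> \<in> T. tile_row \<tau> = Suc y \<and> Q True x y \<tau>} \<union> select Q ((x, Suc y) # q) T"
proof -
  let ?q = "(x, Suc y) # q"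
  let ?p = "(Suc x, y) # (x, y) # ?q"
  have NL: "NL_step ?p (Suc (Suc i)) x' y' \<longleftrightarrow> NL_step ?q i x' y'" for i x' y'
    by (cases i) (auto simp: NL_step_Cons_0 NL_step_Cons_1 NL_step_Cons_Suc_Suc north_step_Cons_0)
  have ex_nat: "(\<exists>i. P i) \<longleftrightarrow> P 0 \<or> (\<exists>i. P (Suc i))" for P :: "nat \<Rightarrow> bool"
    by (metis not0_implies_Suc)
  show ?thesis
    by (subst select_Cons, subst ex_nat)
      (auto simp: NL north_step_Cons_0 north_step_Cons_Suc NL_step_Cons_1 select_def)
qed

lemma select_cong:
  assumes "\<And>i x y. north_step p i x y \<Longrightarrow> Q (NL_step p i x y) x y = Q' (NL_step p i x y) x y"
  shows "select Q p T = select Q' p T"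
  unfolding select_def by (simp add: assms cong: conj_cong)

lemma north_step_path_from: "north_step (path_from N T x y) i x' y' \<Longrightarrow> y \<le> y'"
  unfolding north_step_def by (metis Suc_lessD nth_mem path_from_rows)

definition completion ::
    "(bool \<Rightarrow> nat \<Rightarrow> nat \<Rightarrow> tile \<Rightarrow> bool) \<Rightarrow> nat \<Rightarrow> tile set \<Rightarrow> nat \<Rightarrow> nat \<Rightarrow>
      (nat \<times> nat) list \<times> tile set" where
  "completion Q N T x y = (path_from N T x y, select Q (path_from N T x y) T)"

text \<open>Puts a path segment \<open>q\<close> through one row, together with the tiles \<open>K\<close> kept in it, in front of the
continuation \<open>P\<close> in the rows above.\<close>

definition attach ::
    "(nat \<times> nat) list \<Rightarrow> tile set \<Rightarrow> (nat \<times> nat) list \<times> tile set \<Rightarrow> (nat \<times> nat) list \<times> tile set" where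
  "attach q K P = (q @ fst P, K \<union> snd P)"

text \<open>From height \<open>Suc y\<close> on, the tiles of row \<open>Suc y\<close> affect neither the path nor the tiles kept.\<close>

lemma select_upper:
  assumes K: "K \<in> tilings (seg (Suc y) a b)" and L: "L \<in> tilings (upper N (Suc y))"
  shows "path_from N (K \<union> L) x (Suc y) = path_from N L x (Suc y)"
    and "select Q (path_from N L x (Suc y)) (K \<union> L) = select Q (path_from N L x (Suc y)) L"
    and "{\<tau> \<in> K \<union> L. tile_row \<tau> = Suc y \<and> P \<tau>} = {\<tau> \<in> K. P \<tau>}"
proof -
  have K_row: "tile_row \<tau> = Suc y" if "\<tau> \<in> K" for \<tau>
    using tilings_boxes[OF K that] by (cases \<tau>) auto
  have L_row: "Suc y < tile_row \<tau>" if "\<tau> \<in> L" for \<tau>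
    using tilings_boxes[OF L that] by (cases \<tau>) (auto simp: upper_def)
  show "path_from N (K \<union> L) x (Suc y) = path_from N L x (Suc y)"
    by (rule path_from_cong) (use K_row in fastforce)
  have "\<tau> \<notin> K" if "north_step (path_from N L x (Suc y)) i x' y'" "tile_row \<tau> = Suc y'" for \<tau> i x' y'
    using north_step_path_from[OF that(1)] that(2) K_row[of \<tau>] by auto
  thus "select Q (path_from N L x (Suc y)) (K \<union> L) = select Q (path_from N L x (Suc y)) L"
    unfolding select_def by blast
  show "{\<tau> \<in> K \<union> L. tile_row \<tau> = Suc y \<and> P \<tau>} = {\<tau> \<in> K. P \<tau>}"
    using K_row L_row by fastforce
qed

lemma completion_north:
  assumes "K \<in> tilings (seg (Suc y) 1 (N - y))" "L \<in> tilings (upper N (Suc y))"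
    and "x < N - y" "Domino (Suc y) x \<notin> K"
  shows "completion Q N (K \<union> L) x y =
    attach [(x, y)] {\<tau> \<in> K. Q False x y \<tau>} (completion Q N L x (Suc y))"
proof -
  have "Domino (Suc y) x \<notin> L"
    using tilings_boxes[OF assms(2)] by (fastforce simp: upper_def)
  hence "path_from N (K \<union> L) x y = (x, y) # path_from N L x (Suc y)"
    using assms(3,4) select_upper(1)[OF assms(1,2)]
    by (subst path_from_north) (auto simp: north_allowed_def)
  moreover obtain q where q: "path_from N L x (Suc y) = (x, Suc y) # q"
    using path_from_Cons by blast
  ultimately show ?thesis
    using select_upper(2)[OF assms(1,2), of Q x]
    by (simp add: completion_def attach_def select_north select_upper(3)[OF assms(1,2)] del: Un_iff)
qed

text \<open>A single west step always suffices. If a domino blocked the first north step, then it covers the box to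
the left of that step, so no other domino can block the north step one unit further west. If the border
blocked it, then one unit further west is exactly the border of the row.\<close>

lemma completion_west_north:
  assumes "K \<in> tilings (seg (Suc y) 1 (N - y))" "L \<in> tilings (upper N (Suc y))" "y < N"
    and "Suc x = N - y \<or> Domino (Suc y) (Suc x) \<in> K"
  shows "completion Q N (K \<union> L) (Suc x) y =
    attach [(Suc x, y), (x, y)] {\<tau> \<in> K. Q True x y \<tau>} (completion Q N L x (Suc y))"
proof -
  have D: "Suc (Suc x) < N - y" "Domino (Suc y) x \<notin> K" if "Domino (Suc y) (Suc x) \<in> K"
  proof -
    show "Suc (Suc x) < N - y" using tilings_boxes[OF assms(1) that] by simp
    show "Domino (Suc y) x \<notin> K"
      using tilings_unique[OF assms(1) that, of "Domino (Suc y) x" "(Suc y, Suc x)"] by auto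
  qed
  have "Domino (Suc y) x \<notin> K" if "Suc x = N - y"
    using tilings_boxes[OF assms(1), of "Domino (Suc y) x"] that by auto
  hence "Domino (Suc y) x \<notin> K" using D assms(4) by blast
  moreover have "Domino (Suc y) x \<notin> L"
    using tilings_boxes[OF assms(2)] by (fastforce simp: upper_def)
  ultimately have "north_allowed N (K \<union> L) x y"
    using assms(3,4) D(1) by (auto simp: north_allowed_def)
  moreover have "\<not> north_allowed N (K \<union> L) (Suc x) y"
    using assms(3,4) by (auto simp: north_allowed_def)
  ultimately have "path_from N (K \<union> L) (Suc x) y = (Suc x, y) # (x, y) # path_from N L x (Suc y)"
    using select_upper(1)[OF assms(1,2)] by (simp add: path_from_west path_from_north)
  moreover obtain q where q: "path_from N L x (Suc y) = (x, Suc y) # q"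
    using path_from_Cons by blast
  ultimately show ?thesis
    using select_upper(2)[OF assms(1,2), of Q x]
    by (simp add: completion_def attach_def select_west_north select_upper(3)[OF assms(1,2)] del: Un_iff)
qed

definition prepend ::
    "(nat \<times> nat) list \<Rightarrow> tile set set \<Rightarrow> ((nat \<times> nat) list \<times> tile set) set \<Rightarrow>
      ((nat \<times> nat) list \<times> tile set) set" where
  "prepend q F Z = (\<lambda>(K, P). attach q K P) ` (F \<times> Z)"

lemma image_unions_prepend:
  assumes "\<And>K L. K \<in> F \<Longrightarrow> L \<in> G \<Longrightarrow> f (K \<union> L) = attach q (g K) (c L)"
  shows "f ` unions F G = prepend q (g ` F) (c ` G)"
proof -
  have "f ` unions F G = (\<lambda>(K, L). attach q (g K) (c L)) ` (F \<times> G)"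
    unfolding unions_def image_image by (rule image_cong) (use assms in auto)
  also have "\<dots> = prepend q (g ` F) (c ` G)"
    unfolding prepend_def by (auto simp: image_iff) blast+
  finally show ?thesis .
qed

lemma unions_Un_left: "unions (F \<union> F') G = unions F G \<union> unions F' G"
  by (auto simp: unions_def)

text \<open>Equal partial tilings come from equal data: the segment \<open>q\<close> has a fixed length, so the path of the
continuation can be read off, and the tiles are told apart by their regions.\<close>

lemma sum_wt_prepend:
  assumes "\<And>K. K \<in> F \<Longrightarrow> inside A K" "\<And>P. P \<in> Z \<Longrightarrow> inside B (snd P)" "A \<inter> B = {}"
  shows "(\<Sum>P\<in>prepend q F Z. wt P) = gf F * (\<Sum>P\<in>Z. wt P)"
proof -
  have inj: "inj_on (\<lambda>(K, P). attach q K P) (F \<times> Z)"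
    using inside_union_eqD[OF assms(1) assms(2) assms(1) assms(2) assms(3)]
    by (fastforce simp: inj_on_def attach_def)
  have wt: "wt (attach q K P) = weight K * wt P" if "K \<in> F" "P \<in> Z" for K P
  proof -
    have "finite K" "finite (snd P)"
      using assms(1)[OF that(1)] assms(2)[OF that(2)] by (auto simp: inside_def)
    thus ?thesis
      using weight_union[OF assms(1)[OF that(1)] assms(2)[OF that(2)] assms(3)]
        wt_eq_weight[of "snd P" "fst P"]
      by (simp add: attach_def wt_eq_weight)
  qed
  have "(\<Sum>P\<in>prepend q F Z. wt P) = (\<Sum>(K, P)\<in>F \<times> Z. wt (attach q K P))"
    unfolding prepend_def by (subst sum.reindex[OF inj]) (simp add: o_def case_prod_unfold)
  also have "\<dots> = (\<Sum>(K, P)\<in>F \<times> Z. weight K * wt P)"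
    by (rule sum.cong) (auto intro: wt)
  also have "\<dots> = gf F * (\<Sum>P\<in>Z. wt P)"
    by (simp add: gf_def sum_product sum.cartesian_product)
  finally show ?thesis .
qed

section \<open>Summing over the completions of a path\<close>

text \<open>The rule for the rows above the first one.\<close>

definition keep_rule :: "bool \<Rightarrow> nat \<Rightarrow> nat \<Rightarrow> tile \<Rightarrow> bool" where
  "keep_rule NL x y \<tau> = (if NL then right_of x \<tau> else left_of x \<tau>)"

definition outcomes :: "nat \<Rightarrow> nat \<Rightarrow> nat \<Rightarrow> ((nat \<times> nat) list \<times> tile set) set" where
  "outcomes N x y = (\<lambda>T. completion keep_rule N T x y) ` tilings (upper N y)"

lemma finite_outcomes: "finite (outcomes N x y)"
  by (simp add: outcomes_def finite_tilings)

lemma outcomes_hd: "P \<in> outcomes N x y \<Longrightarrow> \<exists>p. fst P = (x, y) # p"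
  using path_from_Cons by (auto simp: outcomes_def completion_def)

lemma inside_outcomes:
  assumes "P \<in> outcomes N x y"
  shows "inside (upper N y) (snd P)"
proof -
  obtain T where T: "T \<in> tilings (upper N y)" "snd P = select keep_rule (path_from N T x y) T"
    using assms by (auto simp: outcomes_def completion_def)
  have "snd P \<subseteq> T" using T(2) by (auto simp: select_def)
  thus ?thesis
    using inside_tilings[OF finite_upper T(1)] unfolding inside_def by (blast intro: finite_subset)
qed

text \<open>The second vertex of the path tells whether its first step goes north or west.\<close>

lemma prepend_disjoint:
  "prepend [(x, y)] F (outcomes N x (Suc y)) \<inter> prepend [(x, y), (x', y)] G Z = {}"
proof -
  have "fst P ! 1 = (x, Suc y)" if P: "P \<in> prepend [(x, y)] F (outcomes N x (Suc y))" for P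
    using P outcomes_hd by (fastforce simp: prepend_def attach_def)
  moreover have "fst P ! 1 = (x', y)" if "P \<in> prepend [(x, y), (x', y)] G Z" for P
    using that by (auto simp: prepend_def attach_def)
  ultimately show ?thesis by fastforce
qed

lemma finite_prepend: "finite F \<Longrightarrow> finite Z \<Longrightarrow> finite (prepend q F Z)"
  by (simp add: prepend_def)

lemma sum_wt_prepend_union:
  assumes F: "finite F" "\<And>K. K \<in> F \<Longrightarrow> inside (seg (Suc y) a b) K"
    and G: "finite G" "\<And>K. K \<in> G \<Longrightarrow> inside (seg (Suc y) a b) K"
  shows "(\<Sum>P\<in>prepend [(x, y)] F (outcomes N x (Suc y)) \<union>
        prepend [(x, y), (x', y)] G (outcomes N x' (Suc y)). wt P) =
      gf F * (\<Sum>P\<in>outcomes N x (Suc y). wt P) + gf G * (\<Sum>P\<in>outcomes N x' (Suc y). wt P)"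
  using sum_wt_prepend[OF F(2) inside_outcomes seg_upper_disjoint, where F = F]
    sum_wt_prepend[OF G(2) inside_outcomes seg_upper_disjoint, where F = G]
  by (subst sum.union_disjoint) (auto simp: finite_prepend F(1) G(1) finite_outcomes prepend_disjoint)

lemma boxes_seg_iff:
  assumes "boxes \<tau> \<subseteq> seg r a b"
  shows "b \<le> Suc x \<Longrightarrow> left_of x \<tau>" "x < a \<Longrightarrow> \<not> left_of x \<tau>"
    "x < a \<Longrightarrow> right_of x \<tau>" "b \<le> Suc x \<Longrightarrow> \<not> right_of x \<tau>"
  using assms by (cases \<tau>; auto simp: left_of_def right_of_def)+

lemma image_filter_unions_left:
  assumes "\<And>K \<tau>. K \<in> F \<Longrightarrow> \<tau> \<in> K \<Longrightarrow> P \<tau>" "\<And>L \<tau>. L \<in> G \<Longrightarrow> \<tau> \<in> L \<Longrightarrow> \<not> P \<tau>" "G \<noteq> {}"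
  shows "(\<lambda>K. {\<tau> \<in> K. P \<tau>}) ` unions F G = F"
proof -
  have eq: "{\<tau> \<in> K \<union> L. P \<tau>} = K" if "K \<in> F" "L \<in> G" for K L
    using assms(1)[OF that(1)] assms(2)[OF that(2)] by auto
  have "(\<lambda>K. {\<tau> \<in> K. P \<tau>}) ` unions F G = (\<lambda>(K, L). K) ` (F \<times> G)"
    unfolding unions_def image_image by (rule image_cong) (use eq in auto)
  thus ?thesis using assms(3) by force
qed

lemma unions_commute: "unions F G = unions G F"
  by (auto simp: unions_def image_iff)

lemma image_filter_unions_right:
  assumes "\<And>K \<tau>. K \<in> F \<Longrightarrow> \<tau> \<in> K \<Longrightarrow> \<not> P \<tau>" "\<And>L \<tau>. L \<in> G \<Longrightarrow> \<tau> \<in> L \<Longrightarrow> P \<tau>" "F \<noteq> {}"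
  shows "(\<lambda>K. {\<tau> \<in> K. P \<tau>}) ` unions F G = G"
  using image_filter_unions_left[of G P F] assms by (simp add: unions_commute)

text \<open>After a north step that is not preceded by a west step, forgetting the tiles to its right leaves an
arbitrary tiling of the \<open>x\<close> boxes to its left.\<close>

lemma kept_left:
  assumes "Suc x \<le> b"
  shows "(\<lambda>K. {\<tau> \<in> K. left_of x \<tau>}) ` {K \<in> tilings (seg r 1 b). Domino r x \<notin> K} =
    tilings (seg r 1 (Suc x))"
proof -
  have "{K \<in> tilings (seg r 1 b). Domino r x \<notin> K} =
      unions (tilings (seg r 1 (Suc x))) (tilings (seg r (Suc x) b))"
    by (rule tilings_seg_without_domino) (use assms in auto)
  moreover have "(\<lambda>K. {\<tau> \<in> K. left_of x \<tau>}) ` \<dots> = tilings (seg r 1 (Suc x))"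
  proof (rule image_filter_unions_left)
    show "left_of x \<tau>" if "K \<in> tilings (seg r 1 (Suc x))" "\<tau> \<in> K" for K \<tau>
      using boxes_seg_iff(1)[OF tilings_boxes[OF that]] by simp
    show "\<not> left_of x \<tau>" if "L \<in> tilings (seg r (Suc x) b)" "\<tau> \<in> L" for L \<tau>
      using boxes_seg_iff(2)[OF tilings_boxes[OF that]] by simp
  qed (rule tilings_nonempty)
  ultimately show ?thesis by simp
qed

text \<open>After a west step forced by a domino, what remains is that domino and an arbitrary tiling of the boxes
to its right.\<close>

lemma kept_right:
  assumes "Suc (Suc (Suc x)) \<le> b"
  shows "(\<lambda>K. {\<tau> \<in> K. right_of x \<tau>}) ` {K \<in> tilings (seg r 1 b). Domino r (Suc x) \<in> K} =
    unions {{Domino r (Suc x)}} (tilings (seg r (Suc (Suc (Suc x))) b))"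
proof -
  have "{K \<in> tilings (seg r 1 b). Domino r (Suc x) \<in> K} = unions (tilings (seg r 1 (Suc x)))
      (unions {{Domino r (Suc x)}} (tilings (seg r (Suc (Suc (Suc x))) b)))"
    by (rule tilings_seg_with_domino) (use assms in auto)
  moreover have "(\<lambda>K. {\<tau> \<in> K. right_of x \<tau>}) ` \<dots> =
      unions {{Domino r (Suc x)}} (tilings (seg r (Suc (Suc (Suc x))) b))"
  proof (rule image_filter_unions_right)
    show "\<not> right_of x \<tau>" if "K \<in> tilings (seg r 1 (Suc x))" "\<tau> \<in> K" for K \<tau>
      using boxes_seg_iff(4)[OF tilings_boxes[OF that]] by simp
    show "right_of x \<tau>"
      if K: "K \<in> unions {{Domino r (Suc x)}} (tilings (seg r (Suc (Suc (Suc x))) b))"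
        and \<tau>: "\<tau> \<in> K" for K \<tau>
    proof -
      obtain L where L: "L \<in> tilings (seg r (Suc (Suc (Suc x))) b)" "K = {Domino r (Suc x)} \<union> L"
        using K unfolding unions_def by blast
      show ?thesis
        using \<tau> L boxes_seg_iff(3)[OF tilings_boxes[OF L(1)], of \<tau> x] by (auto simp: right_of_def)
    qed
  qed (rule tilings_nonempty)
  ultimately show ?thesis by simp
qed

lemma no_domino_out_of_seg:
  assumes "x < a \<or> b \<le> Suc x"
  shows "{K \<in> tilings (seg r a b). Domino r x \<in> K} = {}"
  using tilings_boxes[of _ "seg r a b" "Domino r x"] assms by fastforce

text \<open>The formula covers a domino that would stick out of the row by one box: then there are no such
tilings, in accordance with \<open>lucas 0 = 0\<close>.\<close>

lemma gf_kept_right: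
  assumes "Suc (Suc x) \<le> b"
  shows "gf ((\<lambda>K. {\<tau> \<in> K. right_of x \<tau>}) ` {K \<in> tilings (seg r 1 b). Domino r (Suc x) \<in> K}) =
    lucas_t * lucas (b - Suc (Suc x))"
proof (cases "b = Suc (Suc x)")
  case True
  have "{K \<in> tilings (seg r 1 b). Domino r (Suc x) \<in> K} = {}"
    by (rule no_domino_out_of_seg) (use True in auto)
  hence "gf ((\<lambda>K. {\<tau> \<in> K. right_of x \<tau>}) ` {K \<in> tilings (seg r 1 b). Domino r (Suc x) \<in> K}) = 0"
    by (simp only: image_empty gf_def sum.empty)
  thus ?thesis using True by simp
next
  case False
  define l where "l = b - Suc (Suc (Suc x))"
  have b: "b = Suc (Suc (Suc x)) + l" using assms False by (simp add: l_def)
  let ?G = "tilings (seg r (Suc (Suc (Suc x))) b)"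
  have "gf (unions {{Domino r (Suc x)}} ?G) = lucas_t * gf ?G"
    by (rule gf_unions_domino[OF inside_seg])
  also have "\<dots> = lucas_t * lucas (Suc l)" unfolding b by (simp only: gf_seg)
  finally show ?thesis using b by (subst kept_right) auto
qed

lemma outcomes_interior:
  assumes "x < N - y"
  shows "outcomes N x y =
    prepend [(x, y)] ((\<lambda>K. {\<tau> \<in> K. left_of x \<tau>}) `
        {K \<in> tilings (seg (Suc y) 1 (N - y)). Domino (Suc y) x \<notin> K}) (outcomes N x (Suc y)) \<union>
    prepend [(x, y), (x - 1, y)] ((\<lambda>K. {\<tau> \<in> K. right_of (x - 1) \<tau>}) `
        {K \<in> tilings (seg (Suc y) 1 (N - y)). Domino (Suc y) x \<in> K}) (outcomes N (x - 1) (Suc y))"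
proof -
  let ?row = "tilings (seg (Suc y) 1 (N - y))" and ?G = "tilings (upper N (Suc y))"
  let ?D = "Domino (Suc y) x"
  let ?f = "\<lambda>T. completion keep_rule N T x y"
  have split: "?row = {K \<in> ?row. ?D \<notin> K} \<union> {K \<in> ?row. ?D \<in> K}" by blast
  have "outcomes N x y = ?f ` unions ?row ?G"
    unfolding outcomes_def using assms by (subst tilings_upper) auto
  also have "\<dots> = ?f ` unions {K \<in> ?row. ?D \<notin> K} ?G \<union> ?f ` unions {K \<in> ?row. ?D \<in> K} ?G"
    by (subst split) (simp only: unions_Un_left image_Un)
  also have "?f ` unions {K \<in> ?row. ?D \<notin> K} ?G =
      prepend [(x, y)] ((\<lambda>K. {\<tau> \<in> K. left_of x \<tau>}) ` {K \<in> ?row. ?D \<notin> K}) (outcomes N x (Suc y))"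
    unfolding outcomes_def
    by (rule image_unions_prepend) (use assms in \<open>simp add: completion_north keep_rule_def\<close>)
  also have "?f ` unions {K \<in> ?row. ?D \<in> K} ?G =
      prepend [(x, y), (x - 1, y)]
        ((\<lambda>K. {\<tau> \<in> K. right_of (x - 1) \<tau>}) ` {K \<in> ?row. ?D \<in> K}) (outcomes N (x - 1) (Suc y))"
    unfolding outcomes_def
  proof (rule image_unions_prepend)
    fix K L assume K: "K \<in> {K \<in> ?row. ?D \<in> K}" and L: "L \<in> ?G"
    hence "1 \<le> x" using tilings_boxes[of K "seg (Suc y) 1 (N - y)" ?D] by auto
    then obtain x' where x: "x = Suc x'" by (cases x) auto
    show "?f (K \<union> L) = attach [(x, y), (x - 1, y)] {\<tau> \<in> K. right_of (x - 1) \<tau>}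
        (completion keep_rule N L (x - 1) (Suc y))"
      using K L assms completion_west_north[of K y N L x' keep_rule] by (simp add: x keep_rule_def)
  qed
  finally show ?thesis .
qed

text \<open>The north step now runs along the end of the row, so no boxes lie to its right and nothing is kept.\<close>

lemma outcomes_boundary:
  assumes "Suc x = N - y"
  shows "outcomes N (Suc x) y = prepend [(Suc x, y), (x, y)] {{}} (outcomes N x (Suc y))"
proof -
  let ?row = "tilings (seg (Suc y) 1 (N - y))" and ?G = "tilings (upper N (Suc y))"
  let ?f = "\<lambda>T. completion keep_rule N T (Suc x) y"
  have "outcomes N (Suc x) y = ?f ` unions ?row ?G"
    unfolding outcomes_def using assms by (subst tilings_upper) auto
  also have "\<dots> = prepend [(Suc x, y), (x, y)] ((\<lambda>K. {\<tau> \<in> K. right_of x \<tau>}) ` ?row)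
      (outcomes N x (Suc y))"
    unfolding outcomes_def
  proof (rule image_unions_prepend)
    fix K L assume "K \<in> ?row" "L \<in> ?G"
    thus "?f (K \<union> L) = attach [(Suc x, y), (x, y)] {\<tau> \<in> K. right_of x \<tau>}
        (completion keep_rule N L x (Suc y))"
      using assms completion_west_north[of K y N L x keep_rule] by (simp add: keep_rule_def)
  qed
  also have "(\<lambda>K. {\<tau> \<in> K. right_of x \<tau>}) ` ?row = {{}}"
  proof -
    have "{\<tau> \<in> K. right_of x \<tau>} = {}" if "K \<in> ?row" for K
      using boxes_seg_iff(4)[OF tilings_boxes[OF that], of _ x] assms by auto
    thus ?thesis using tilings_nonempty[of "seg (Suc y) 1 (N - y)"] by fastforce
  qed
  finally show ?thesis .
qed

lemma outcomes_top: "outcomes N 0 N = {([(0, N)], {})}"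
proof -
  have "upper N N = {}" by (auto simp: upper_def)
  moreover have "path_from N {} 0 N = [(0, N)]"
    by (subst path_from.simps) (simp add: north_allowed_def)
  ultimately show ?thesis by (simp add: outcomes_def completion_def select_def)
qed

text \<open>With \<open>h = N - y\<close> north steps left, the outcomes satisfy
\<open>Z(x, h) = {x + 1} Z(x, h - 1) + t {h - x - 1} Z(x - 1, h - 1)\<close> for \<open>x < h\<close>, and \<open>Z(h, h) = Z(h - 1, h - 1)\<close>. By
\<open>{h} = {x + 1} {h - x} + t {x} {h - x - 1}\<close> this is the recursion of the Lucas analogue of the binomial coefficient \<open>h\<close> over \<open>x\<close>.\<close>

lemma sum_wt_outcomes:
  assumes "y \<le> N" "x \<le> N - y"
  shows "(\<Sum>P\<in>outcomes N x y. wt P) * (lucas_fact x * lucas_fact (N - y - x)) = lucas_fact (N - y)"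
  using assms
proof (induction "N - y" arbitrary: x y)
  case 0
  thus ?case by (simp add: outcomes_top wt_def)
next
  case (Suc h)
  have h: "N - Suc y = h" "N - y = Suc h" "Suc y \<le> N" using Suc.hyps(2) by auto
  have IH: "(\<Sum>P\<in>outcomes N x' (Suc y). wt P) * (lucas_fact x' * lucas_fact (h - x')) = lucas_fact h"
    if "x' \<le> h" for x'
    using Suc.hyps(1)[of "Suc y" x'] h that by simp
  show ?case
  proof (cases "x = Suc h")
    case True
    have "(\<Sum>P\<in>outcomes N (Suc h) y. wt P) = (\<Sum>P\<in>outcomes N h (Suc y). wt P)"
      unfolding outcomes_boundary[of h N y, OF h(2)[symmetric]]
      by (subst sum_wt_prepend[OF _ inside_outcomes seg_upper_disjoint[of y 0 0]])
        (auto simp: inside_def)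
    hence "(\<Sum>P\<in>outcomes N x y. wt P) * (lucas_fact x * lucas_fact (N - y - x)) =
        lucas (Suc h) * ((\<Sum>P\<in>outcomes N h (Suc y). wt P) * (lucas_fact h * lucas_fact (h - h)))"
      unfolding True h(2) by (simp only: lucas_fact_Suc) (simp add: ac_simps)
    also have "\<dots> = lucas_fact (Suc h)" unfolding IH[OF order_refl] by (simp only: lucas_fact_Suc)
    finally show ?thesis using h(2) by simp
  next
    case False
    hence x: "x \<le> h" using Suc.prems h by simp
    let ?r = "seg (Suc y) 1 (Suc h)"
    let ?F = "(\<lambda>K. {\<tau> \<in> K. left_of x \<tau>}) ` {K \<in> tilings ?r. Domino (Suc y) x \<notin> K}"
    let ?G = "(\<lambda>K. {\<tau> \<in> K. right_of (x - 1) \<tau>}) ` {K \<in> tilings ?r. Domino (Suc y) x \<in> K}"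
    let ?Z = "\<lambda>x. \<Sum>P\<in>outcomes N x (Suc y). wt P"
    have sub: "inside ?r {\<tau> \<in> K. P \<tau>}" if "K \<in> tilings ?r" for K P
      using inside_seg[OF that] by (auto simp: inside_def)
    have Z: "(\<Sum>P\<in>outcomes N x y. wt P) = gf ?F * ?Z x + gf ?G * ?Z (x - 1)"
      by (subst outcomes_interior; (subst sum_wt_prepend_union[where a = 1 and b = "Suc h"])?)
        (use h x sub in \<open>auto simp: finite_tilings\<close>)
    have F: "gf ?F = lucas (Suc x)"
      using x gf_seg[of "Suc y" 1 x] by (subst kept_left) auto
    have fact: "lucas_fact (Suc h - x) = lucas (Suc (h - x)) * lucas_fact (h - x)"
      using x by (simp add: Suc_diff_le lucas_fact_Suc)
    show ?thesis
    proof (cases x)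
      case 0
      have "{K \<in> tilings ?r. Domino (Suc y) x \<in> K} = {}"
        by (rule no_domino_out_of_seg) (use 0 in auto)
      hence G: "gf ?G = 0" by (simp only: image_empty gf_def sum.empty)
      have "(\<Sum>P\<in>outcomes N x y. wt P) * (lucas_fact x * lucas_fact (N - y - x)) =
          lucas (Suc h) * (?Z 0 * (lucas_fact 0 * lucas_fact (h - 0)))"
        unfolding Z F G by (simp add: 0 h lucas_fact_Suc ac_simps)
      also have "\<dots> = lucas_fact (Suc h)" unfolding IH[OF le0] by (simp only: lucas_fact_Suc)
      finally show ?thesis using h(2) by simp
    next
      case (Suc x')
      have G: "gf ?G = lucas_t * lucas (h - x)"
        using gf_kept_right[of x' "Suc h" "Suc y"] x Suc by simp
      have lf_x: "lucas_fact x = lucas x * lucas_fact x'" and "h - x' = Suc (h - x)"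
        using Suc x by (auto simp: lucas_fact_Suc)
      hence IH': "?Z x' * (lucas_fact x' * (lucas (Suc (h - x)) * lucas_fact (h - x))) = lucas_fact h"
        using IH[of x'] x Suc by (simp add: lucas_fact_Suc)
      have regroup: "(a * z + t * b * z') * (f * (c * g)) = a * c * (z * (f * g)) + t * l * b * (z' * (f' * (c * g)))"
        if "f = l * f'" for a b c f f' g l t z z' :: "int poly poly"
        using that by (simp add: algebra_simps)
      have "(\<Sum>P\<in>outcomes N x y. wt P) * (lucas_fact x * lucas_fact (N - y - x)) =
          lucas (Suc x) * lucas (Suc (h - x)) * (?Z x * (lucas_fact x * lucas_fact (h - x))) +
          lucas_t * lucas x * lucas (h - x) *
            (?Z x' * (lucas_fact x' * (lucas (Suc (h - x)) * lucas_fact (h - x))))"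
        unfolding Z F G h(2) fact using regroup[OF lf_x] Suc by simp
      also have "\<dots> = (lucas (Suc x) * lucas (Suc (h - x)) + lucas_t * lucas x * lucas (h - x)) * lucas_fact h"
        unfolding IH' IH[OF x] by (simp add: algebra_simps)
      also have "\<dots> = lucas_fact (Suc h)"
        using lucas_add[of x "h - x"] x by (simp add: lucas_fact_Suc)
      finally show ?thesis using h by simp
    qed
  qed
qed

section \<open>The first row\<close>

text \<open>Cut the first row into blocks of length \<open>n\<close>, numbered from \<open>0\<close>, so that block \<open>l\<close> ends with box
\<open>Suc l * n\<close>. The index is the first block from \<open>m\<close> on without a domino starting at the box
\<open>Suc l * n - 1\<close>. Letting \<open>m\<close> vary makes an induction over the blocks possible.\<close>

definition block_index :: "nat \<Rightarrow> nat \<Rightarrow> tile set \<Rightarrow> nat" where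
  "block_index n m K = (LEAST l. m \<le> l \<and> Domino 1 (Suc l * n - 1) \<notin> K)"

text \<open>The blank leaves out the last box of its block, since a tile on that box may reach into the next block.\<close>

definition block_kept :: "nat \<Rightarrow> nat \<Rightarrow> tile set \<Rightarrow> tile set" where
  "block_kept n m K = (let l = block_index n m K in
     {\<tau> \<in> K. \<not> boxes \<tau> \<subseteq> seg 1 (Suc (l * n)) (Suc l * n)})"

lemma block_index_stop: "Domino 1 (Suc m * n - 1) \<notin> K \<Longrightarrow> block_index n m K = m"
  unfolding block_index_def by (rule Least_equality) auto

lemma block_index_continue:
  assumes "Domino 1 (Suc m * n - 1) \<in> K"
  shows "block_index n m K = block_index n (Suc m) K"
proof -
  have "m \<le> l \<and> Domino 1 (Suc l * n - 1) \<notin> K \<longleftrightarrow> Suc m \<le> l \<and> Domino 1 (Suc l * n - 1) \<notin> K" for l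
    using assms by (cases "l = m") auto
  thus ?thesis by (simp only: block_index_def)
qed

lemma block_index_ge:
  assumes "m \<le> l" "Domino 1 (Suc l * n - 1) \<notin> K"
  shows "m \<le> block_index n m K"
  unfolding block_index_def by (rule conjunct1[OF LeastI[of _ l]]) (use assms in auto)

text \<open>The defining minimum of \<open>first_row_index\<close> also asks for a domino at the end of the preceding block; at the
first block that lacks its final domino this is automatic, as all earlier ones have theirs.\<close>

lemma first_row_index_eq:
  assumes D: "Domino 1 (n - 1) \<in> K" and "Domino 1 (Suc k * n - 1) \<notin> K"
  shows "first_row_index n K = block_index n 0 K"
proof -
  let ?P = "\<lambda>l. 0 \<le> l \<and> Domino 1 (Suc l * n - 1) \<notin> K"
  let ?l = "block_index n 0 K"
  have l: "?P ?l" and least: "\<And>j. ?P j \<Longrightarrow> ?l \<le> j"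
    using LeastI[of ?P k] Least_le[of ?P] assms(2) by (simp_all add: block_index_def)
  have "?l \<noteq> 0" using l D by (metis One_nat_def mult_1)
  then obtain l' where l': "?l = Suc l'" by (cases ?l) auto
  have "\<not> ?P l'" using least[of l'] l' by linarith
  hence "Domino 1 (?l * n - 1) \<in> K" using l' by simp
  thus ?thesis
    unfolding first_row_index_def using l l' least
    by (intro Least_equality) (auto simp: Suc_eq_plus1[symmetric])
qed

text \<open>If the block \<open>m\<close> does not end in a domino, then the line in front of its last box cuts no tile:
the boxes before that line become blank, and those after it are tiled arbitrarily.\<close>

lemma block_kept_image_stop:
  assumes "2 \<le> n" "m \<le> k"
  shows "block_kept n m `
      {K \<in> tilings (seg 1 (Suc (m * n)) (Suc k * n)). Domino 1 (Suc m * n - 1) \<notin> K} =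
    tilings (seg 1 (Suc m * n) (Suc k * n))"
proof -
  let ?A = "seg 1 (Suc (m * n)) (Suc m * n)" and ?B = "seg 1 (Suc m * n) (Suc k * n)"
  let ?F = "{K \<in> tilings (seg 1 (Suc (m * n)) (Suc k * n)). Domino 1 (Suc m * n - 1) \<notin> K}"
  have x: "Suc (Suc m * n - 1) = Suc m * n" using assms(1) by simp
  have "Suc m * n \<le> Suc k * n" using assms(2) by (intro mult_le_mono) auto
  hence F: "?F = unions (tilings ?A) (tilings ?B)"
    using tilings_seg_without_domino[of "Suc (m * n)" "Suc m * n - 1" "Suc k * n" 1] assms(1)
    by (simp only: x) auto
  have "block_kept n m ` ?F = (\<lambda>K. {\<tau> \<in> K. \<not> boxes \<tau> \<subseteq> ?A}) ` ?F"
    by (rule image_cong) (simp_all add: block_kept_def block_index_stop del: mult_Suc)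
  also have "\<dots> = tilings ?B"
    unfolding F
  proof (rule image_filter_unions_right)
    show "\<not> \<not> boxes \<tau> \<subseteq> ?A" if "K \<in> tilings ?A" "\<tau> \<in> K" for K \<tau>
      using tilings_boxes[OF that] by simp
    show "\<not> boxes \<tau> \<subseteq> ?A" if "K \<in> tilings ?B" "\<tau> \<in> K" for K \<tau>
      using tilings_boxes[OF that] seg_disjoint[of "Suc m * n" "Suc m * n" 1] boxes_nonempty[of \<tau>]
      by blast
  qed (rule tilings_nonempty)
  finally show ?thesis .
qed

lemma block_kept_continue:
  assumes "2 \<le> n" "m < k"
    and A: "A \<in> tilings (seg 1 (Suc (m * n)) (Suc m * n - 1))"
    and B: "B \<in> tilings (seg 1 (Suc (Suc m * n)) (Suc k * n))"
  shows "block_kept n m (A \<union> ({Domino 1 (Suc m * n - 1)} \<union> B)) =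
    A \<union> ({Domino 1 (Suc m * n - 1)} \<union> block_kept n (Suc m) B)"
proof -
  let ?D = "Domino 1 (Suc m * n - 1)"
  let ?K = "A \<union> ({?D} \<union> B)"
  \<comment> \<open>From block \<open>Suc m\<close> on, only the tiles of \<open>B\<close> matter, so the index and the blank are those of \<open>B\<close>.\<close>
  have same: "Domino 1 (Suc l * n - 1) \<in> ?K \<longleftrightarrow> Domino 1 (Suc l * n - 1) \<in> B" if "Suc m \<le> l" for l
  proof -
    have "Suc (Suc m) * n \<le> Suc l * n" using that by (intro mult_le_mono) auto
    hence "Suc m * n < Suc l * n - 1" using assms(1) by simp
    moreover from this have "Domino 1 (Suc l * n - 1) \<notin> A"
      using tilings_boxes[OF A, of "Domino 1 (Suc l * n - 1)"] by auto
    ultimately show ?thesis by auto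
  qed
  have "block_index n m ?K = block_index n (Suc m) ?K"
    by (rule block_index_continue) simp
  also have "\<dots> = block_index n (Suc m) B"
    unfolding block_index_def using same by (metis (no_types, lifting))
  finally have index: "block_index n m ?K = block_index n (Suc m) B" .
  let ?l = "block_index n (Suc m) B"
  have "Domino 1 (Suc k * n - 1) \<notin> B"
    using tilings_boxes[OF B, of "Domino 1 (Suc k * n - 1)"] assms(1) by auto
  hence l: "Suc m \<le> ?l"
    using assms(2) by (intro block_index_ge[of _ k]) auto
  hence "Suc m * n \<le> ?l * n" by (intro mult_le_mono) auto
  hence blank: "(1, j) \<notin> seg 1 (Suc (?l * n)) (Suc ?l * n)" if "j \<le> Suc m * n" for j
    using that by auto
  have "\<not> boxes \<tau> \<subseteq> seg 1 (Suc (?l * n)) (Suc ?l * n)" if "\<tau> \<in> A" for \<tau>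
  proof -
    have "boxes \<tau> \<subseteq> seg 1 (Suc (m * n)) (Suc m * n - 1)" using tilings_boxes[OF A that] .
    moreover obtain i j where "(i, j) \<in> boxes \<tau>" using boxes_nonempty[of \<tau>] by fast
    ultimately have "(i, j) \<in> seg 1 (Suc (m * n)) (Suc m * n - 1)" "(i, j) \<in> boxes \<tau>" by blast+
    moreover from this have "i = 1" "j \<le> Suc m * n" by auto
    ultimately show ?thesis using blank[of j] by blast
  qed
  moreover have "\<not> boxes ?D \<subseteq> seg 1 (Suc (?l * n)) (Suc ?l * n)"
    using blank[of "Suc m * n - 1"] by (metis boxes.simps(2) diff_le_self insert_subset)
  ultimately show ?thesis
    unfolding block_kept_def index Let_def by blast
qed

text \<open>If the block \<open>m\<close> ends in a domino, the tiles before that domino are kept and the search for the blank goes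
on to its right.\<close>

lemma block_kept_image_continue:
  assumes "2 \<le> n" "m < k"
  shows "block_kept n m `
      {K \<in> tilings (seg 1 (Suc (m * n)) (Suc k * n)). Domino 1 (Suc m * n - 1) \<in> K} =
    unions (tilings (seg 1 (Suc (m * n)) (Suc m * n - 1)))
      (unions {{Domino 1 (Suc m * n - 1)}}
        (block_kept n (Suc m) ` tilings (seg 1 (Suc (Suc m * n)) (Suc k * n))))"
proof -
  let ?F = "{K \<in> tilings (seg 1 (Suc (m * n)) (Suc k * n)). Domino 1 (Suc m * n - 1) \<in> K}"
  let ?A = "tilings (seg 1 (Suc (m * n)) (Suc m * n - 1))"
  let ?B = "tilings (seg 1 (Suc (Suc m * n)) (Suc k * n))"
  let ?D = "Domino 1 (Suc m * n - 1)"
  have x: "Suc (Suc m * n - 1) = Suc m * n" using assms(1) by simp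
  have "Suc (Suc m) * n \<le> Suc k * n" using assms(2) by (intro mult_le_mono) auto
  hence F: "?F = unions ?A (unions {{?D}} ?B)"
    using tilings_seg_with_domino[of "Suc (m * n)" "Suc m * n - 1" "Suc k * n" 1] assms(1)
    by (simp only: x) auto
  have "block_kept n m ` ?F =
      (\<lambda>(A, B). A \<union> ({?D} \<union> block_kept n (Suc m) B)) ` (?A \<times> ?B)"
    unfolding F unions_def by (force simp: image_iff block_kept_continue[OF assms, simplified])
  also have "\<dots> = unions ?A (unions {{?D}} (block_kept n (Suc m) ` ?B))"
    unfolding unions_def by (force simp: image_iff)
  finally show ?thesis .
qed

lemma inside_block_kept:
  assumes "L \<in> block_kept n m ` tilings (seg r a b)"
  shows "inside (seg r a b) L"
  using assms inside_seg by (fastforce simp: block_kept_def inside_def Let_def)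

text \<open>Write \<open>c(j)\<close> for the generating function with \<open>j = k - m\<close> further blocks. Stopping or continuing gives
\<open>c(j) = {j n + 1} + t {n - 1} c(j - 1)\<close> for \<open>j \<ge> 1\<close>, and \<open>c(0) = 1\<close>. The addition formula
\<open>{(j + 1) n} = {n} {j n + 1} + t {n - 1} {j n}\<close> has the same shape, whence \<open>{n} c(j) = {(j + 1) n}\<close>.\<close>

lemma gf_block_kept:
  assumes "2 \<le> n" "m \<le> k"
  shows "lucas n * gf (block_kept n m ` tilings (seg 1 (Suc (m * n)) (Suc k * n))) =
    lucas (Suc (k - m) * n)"
  using assms(2)
proof (induction "k - m" arbitrary: m)
  case 0
  hence m: "m = k" by simp
  let ?T = "tilings (seg 1 (Suc (k * n)) (Suc k * n))"
  have "{K \<in> ?T. Domino 1 (Suc k * n - 1) \<in> K} = {}"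
    by (rule no_domino_out_of_seg) (use assms(1) in auto)
  hence "?T = {K \<in> ?T. Domino 1 (Suc k * n - 1) \<notin> K}" by blast
  hence "block_kept n k ` ?T = tilings (seg 1 (Suc k * n) (Suc k * n))"
    using block_kept_image_stop[OF assms(1), of k k] by simp
  thus ?case using m by simp
next
  case (Suc d)
  hence m: "m < k" and d: "d = k - Suc m" "k - m = Suc d" by auto
  let ?T = "tilings (seg 1 (Suc (m * n)) (Suc k * n))" and ?D = "Domino 1 (Suc m * n - 1)"
  let ?N = "{K \<in> ?T. ?D \<notin> K}" and ?Y = "{K \<in> ?T. ?D \<in> K}"
  let ?next = "block_kept n (Suc m) ` tilings (seg 1 (Suc (Suc m * n)) (Suc k * n))"
  have len: "Suc k * n = Suc m * n + Suc d * n"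
  proof -
    have "Suc k = Suc m + Suc d" using m d by simp
    thus ?thesis by (simp only: add_mult_distrib)
  qed
  have len': "Suc m * n - 1 = Suc (m * n) + (n - 2)" "Suc (n - 2) = n - 1" using assms(1) by simp_all
  have x: "Suc (Suc m * n - 1) = Suc m * n" using assms(1) by simp
  have stop: "gf (block_kept n m ` ?N) = lucas (Suc (Suc d * n))"
    unfolding block_kept_image_stop[OF assms(1) less_imp_le[OF m]] by (subst len, rule gf_seg)
  have "gf (block_kept n m ` ?Y) =
      gf (tilings (seg 1 (Suc (m * n)) (Suc m * n - 1))) * (lucas_t * gf ?next)"
    unfolding block_kept_image_continue[OF assms(1) m]
    by (rule gf_seg_with_domino[of _ "Suc k * n"]; simp only: x)
      (use len assms(1) inside_block_kept in auto)
  also have "gf (tilings (seg 1 (Suc (m * n)) (Suc m * n - 1))) = lucas (n - 1)"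
    unfolding len'(1) gf_seg len'(2) ..
  finally have cont: "gf (block_kept n m ` ?Y) = lucas (n - 1) * (lucas_t * gf ?next)" .
  have split: "?T = ?N \<union> ?Y" by blast
  have disj: "block_kept n m ` ?N \<inter> block_kept n m ` ?Y = {}"
  proof -
    have "?D \<notin> K" if "K \<in> block_kept n m ` ?N" for K
      using that by (auto simp: block_kept_def Let_def)
    moreover have "?D \<in> K" if "K \<in> block_kept n m ` ?Y" for K
      using that unfolding block_kept_image_continue[OF assms(1) m] by (auto simp: unions_def)
    ultimately show ?thesis by blast
  qed
  have "gf (block_kept n m ` ?T) = gf (block_kept n m ` ?N) + gf (block_kept n m ` ?Y)"
    by (subst split, subst image_Un, rule gf_Un_disjoint) (use disj finite_tilings in auto)
  hence "gf (block_kept n m ` ?T) = lucas (Suc (Suc d * n)) + lucas (n - 1) * (lucas_t * gf ?next)"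
    by (simp only: stop cont)
  hence "lucas n * gf (block_kept n m ` ?T) =
      lucas n * lucas (Suc (Suc d * n)) + lucas_t * lucas (n - 1) * (lucas n * gf ?next)"
    by (simp only: distrib_left ac_simps)
  also have "lucas n * gf ?next = lucas (Suc d * n)"
    using Suc.hyps(1)[OF d(1)] m d by simp
  also have "lucas n * lucas (Suc (Suc d * n)) + lucas_t * lucas (n - 1) * lucas (Suc d * n) =
      lucas (Suc (Suc d) * n)"
    using lucas_add[of "n - 1" "Suc d * n"] assms(1) by simp
  finally show ?case using d by simp
qed

definition first_row_kept :: "nat \<Rightarrow> tile set \<Rightarrow> tile set" where
  "first_row_kept n K = {\<tau> \<in> K. right_of (n - 2) \<tau> \<and> \<not> boxes \<tau> \<subseteq> first_row_blank n K}"

text \<open>A path that starts with a west step meets the domino at the end of block \<open>0\<close>. So its kept tiles are those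
of the case \<open>m = 0\<close> of the block decomposition without the tiles in front of that domino.\<close>

lemma gf_first_row_kept:
  assumes "2 \<le> n" "1 \<le> k"
  shows "lucas n * gf (first_row_kept n ` {K \<in> tilings (seg 1 1 (Suc k * n)). Domino 1 (n - 1) \<in> K}) =
    lucas_t * lucas (k * n)"
proof -
  let ?Y = "{K \<in> tilings (seg 1 1 (Suc k * n)). Domino 1 (n - 1) \<in> K}"
  let ?D = "Domino 1 (n - 1)"
  let ?next = "block_kept n 1 ` tilings (seg 1 (Suc n) (Suc k * n))"
  have kept: "first_row_kept n K = {\<tau> \<in> block_kept n 0 K. right_of (n - 2) \<tau>}" if K: "K \<in> ?Y" for K
  proof -
    have "Domino 1 (Suc k * n - 1) \<notin> K"
      using K tilings_boxes[of K "seg 1 1 (Suc k * n)" "Domino 1 (Suc k * n - 1)"] assms(1) by auto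
    hence "first_row_index n K = block_index n 0 K"
      using K by (intro first_row_index_eq) auto
    moreover have "{1} \<times> {m * n + 1 .. (m + 1) * n - 1} = seg 1 (Suc (m * n)) (Suc m * n)" for m
      using assms(1) by (auto simp: seg_def)
    ultimately show ?thesis
      by (auto simp: first_row_kept_def first_row_blank_def block_kept_def Let_def)
  qed
  have Y: "block_kept n 0 ` ?Y = unions (tilings (seg 1 1 (n - 1))) (unions {{?D}} ?next)"
    using block_kept_image_continue[OF assms(1), of 0 k] assms(2) by simp
  have "first_row_kept n ` ?Y = (\<lambda>K. {\<tau> \<in> K. right_of (n - 2) \<tau>}) ` (block_kept n 0 ` ?Y)"
    unfolding image_image by (rule image_cong) (use kept in auto)
  also have "\<dots> = unions {{?D}} ?next"
    unfolding Y
  proof (rule image_filter_unions_right)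
    show "\<not> right_of (n - 2) \<tau>" if "K \<in> tilings (seg 1 1 (n - 1))" "\<tau> \<in> K" for K \<tau>
      using boxes_seg_iff(4)[OF tilings_boxes[OF that]] assms(1) by simp
    show "right_of (n - 2) \<tau>" if K: "K \<in> unions {{?D}} ?next" and \<tau>: "\<tau> \<in> K" for K \<tau>
    proof -
      obtain L where L: "L \<in> ?next" "K = {?D} \<union> L"
        using K unfolding unions_def by blast
      have "right_of (n - 2) \<tau>" if "\<tau> \<in> L"
        using inside_block_kept[OF L(1)] that boxes_seg_iff(3)[of \<tau> 1 "Suc n" "Suc k * n" "n - 2"]
        by (auto simp: inside_def)
      moreover have "right_of (n - 2) ?D" using assms(1) by (auto simp: right_of_def)
      ultimately show ?thesis using \<tau> L by auto
    qed
  qed (rule tilings_nonempty)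
  also have "gf \<dots> = lucas_t * gf ?next"
  proof (rule gf_unions_domino)
    show "inside (seg 1 (Suc (Suc (n - 1))) (Suc k * n)) L" if "L \<in> ?next" for L
      using inside_block_kept[OF that] assms(1) by simp
  qed
  finally have "gf (first_row_kept n ` ?Y) = lucas_t * gf ?next" .
  moreover have "lucas n * gf ?next = lucas (Suc (k - 1) * n)"
    using gf_block_kept[OF assms(1), of 1 k] assms(2) by simp
  ultimately show ?thesis using assms(2) by (simp add: algebra_simps)
qed

definition fc_rule :: "nat \<Rightarrow> tile set \<Rightarrow> bool \<Rightarrow> nat \<Rightarrow> nat \<Rightarrow> tile \<Rightarrow> bool" where
  "fc_rule n T NL x y \<tau> =
     (if y = 0 then NL \<and> right_of x \<tau> \<and> \<not> boxes \<tau> \<subseteq> first_row_blank n T else keep_rule NL x y \<tau>)"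

lemma fc_partial_tiling_eq:
  "fc_partial_tiling n k T = completion (fc_rule n T) (Suc k * n) T (n - 1) 0"
  by (auto simp: fc_partial_tiling_def completion_def fc_path_def kept_tiles_def select_def
      fc_rule_def keep_rule_def)

lemma completion_fc_rule:
  "completion (fc_rule n T) N L x (Suc y) = completion keep_rule N L x (Suc y)"
proof -
  have "select (fc_rule n T) (path_from N L x (Suc y)) L = select keep_rule (path_from N L x (Suc y)) L"
  proof (rule select_cong)
    fix i x' y' assume "north_step (path_from N L x (Suc y)) i x' y'"
    hence "y' \<noteq> 0" using north_step_path_from by fastforce
    thus "fc_rule n T (NL_step (path_from N L x (Suc y)) i x' y') x' y' =
        keep_rule (NL_step (path_from N L x (Suc y)) i x' y') x' y'"
      by (simp add: fc_rule_def fun_eq_iff)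
  qed
  thus ?thesis by (simp add: completion_def)
qed

lemma first_row_blank_upper:
  assumes "L \<in> tilings (upper N 1)"
  shows "first_row_blank n (K \<union> L) = first_row_blank n K"
proof -
  have "Domino 1 j \<notin> L" for j
    using tilings_boxes[OF assms, of "Domino 1 j"] by (auto simp: upper_def)
  thus ?thesis by (simp add: first_row_blank_def first_row_index_def)
qed

lemma fc_partial_tilings_eq:
  assumes "1 \<le> n" "1 \<le> k"
  defines "N \<equiv> Suc k * n"
  shows "fc_partial_tilings n k =
    prepend [(n - 1, 0)] {{}} (outcomes N (n - 1) 1) \<union>
    prepend [(n - 1, 0), (n - 2, 0)]
      (first_row_kept n ` {K \<in> tilings (seg 1 1 N). Domino 1 (n - 1) \<in> K}) (outcomes N (n - 2) 1)"
proof -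
  let ?row = "tilings (seg 1 1 N)" and ?G = "tilings (upper N 1)" and ?D = "Domino 1 (n - 1)"
  let ?f = "fc_partial_tiling n k"
  have f: "?f T = completion (fc_rule n T) N T (n - 1) 0" for T
    by (simp only: fc_partial_tiling_eq N_def)
  have N: "n \<le> N" "0 < N" using assms by (auto simp: N_def)
  have split: "?row = {K \<in> ?row. ?D \<notin> K} \<union> {K \<in> ?row. ?D \<in> K}" by blast
  have "fc_partial_tilings n k = ?f ` tilings (upper N 0)"
    by (simp add: fc_partial_tilings_def is_tiling_iff N_def)
  also have "\<dots> = ?f ` unions ?row ?G"
    using tilings_upper[OF N(2)] by simp
  also have "\<dots> = ?f ` unions {K \<in> ?row. ?D \<notin> K} ?G \<union> ?f ` unions {K \<in> ?row. ?D \<in> K} ?G"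
    by (subst split) (simp only: unions_Un_left image_Un)
  also have "?f ` unions {K \<in> ?row. ?D \<notin> K} ?G =
      prepend [(n - 1, 0)] ((\<lambda>K. {}) ` {K \<in> ?row. ?D \<notin> K}) (outcomes N (n - 1) 1)"
    unfolding outcomes_def
  proof (rule image_unions_prepend)
    fix K L assume "K \<in> {K \<in> ?row. ?D \<notin> K}" "L \<in> ?G"
    thus "?f (K \<union> L) = attach [(n - 1, 0)] {} (completion keep_rule N L (n - 1) 1)"
      using completion_north[of K 0 N L "n - 1" "fc_rule n (K \<union> L)"] N assms(1)
      by (simp add: f completion_fc_rule fc_rule_def)
  qed
  also have "(\<lambda>K. {}) ` {K \<in> ?row. ?D \<notin> K} = ({{}} :: tile set set)"
  proof -
    have "{K \<in> ?row. ?D \<notin> K} = unions (tilings (seg 1 1 (Suc (n - 1)))) (tilings (seg 1 (Suc (n - 1)) N))"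
      by (rule tilings_seg_without_domino) (use N assms(1) in auto)
    hence "{K \<in> ?row. ?D \<notin> K} \<noteq> {}" using tilings_nonempty by (simp add: unions_def)
    thus ?thesis by auto
  qed
  also have "?f ` unions {K \<in> ?row. ?D \<in> K} ?G =
      prepend [(n - 1, 0), (n - 2, 0)] (first_row_kept n ` {K \<in> ?row. ?D \<in> K}) (outcomes N (n - 2) 1)"
    unfolding outcomes_def
  proof (rule image_unions_prepend)
    fix K L assume K: "K \<in> {K \<in> ?row. ?D \<in> K}" and L: "L \<in> ?G"
    hence "2 \<le> n" using tilings_boxes[of K "seg 1 1 N" ?D] by auto
    then obtain x where x: "n - 1 = Suc x" "n - 2 = x" by (metis Suc_diff_Suc Suc_1 Suc_le_lessD)
    have kept: "{\<tau> \<in> K. fc_rule n (K \<union> L) True x 0 \<tau>} = first_row_kept n K"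
      using x by (simp add: fc_rule_def first_row_kept_def first_row_blank_upper[OF L])
    show "?f (K \<union> L) = attach [(n - 1, 0), (n - 2, 0)] (first_row_kept n K)
        (completion keep_rule N L (n - 2) 1)"
      unfolding f x using K L N completion_west_north[of K 0 N L x "fc_rule n (K \<union> L)"]
      by (simp add: completion_fc_rule kept flip: x(1))
  qed
  finally show ?thesis .
qed

text \<open>Let \<open>N = (k + 1) n\<close>, and let \<open>Z(x)\<close> be the sum over the outcomes from \<open>(x, 1)\<close>. The sum in question is
\<open>Z(n - 1) + R Z(n - 2)\<close> with \<open>{n} R = t {k n}\<close>. After clearing denominators the two terms contribute
\<open>{n} {k n + 1}\<close> and \<open>t {n - 1} {k n}\<close> times \<open>{N - 1}!\<close>, and these coefficients add up to \<open>{N}\<close>.\<close>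

lemma sum_wt_fc_partial_tilings:
  assumes "1 \<le> k"
  shows "(\<Sum>P\<in>fc_partial_tilings n k. wt P) * (lucas_fact n * lucas_fact (Suc (k * n))) =
    lucas_fact (Suc k * n)"
proof (cases "n = 0")
  case True
  have "{T. is_tiling 0 T} = {{}}"
  proof -
    have "upper 0 0 = {}" by (auto simp: upper_def)
    thus ?thesis by (simp add: is_tiling_iff)
  qed
  hence "fc_partial_tilings 0 k = {fc_partial_tiling 0 k {}}"
    by (simp add: fc_partial_tilings_def)
  moreover have "wt (fc_partial_tiling 0 k {}) = 1"
    by (simp add: fc_partial_tiling_def kept_tiles_def wt_def)
  ultimately show ?thesis using True by (simp add: lucas_fact_Suc)
next
  case False
  then obtain x where n: "n = Suc x" by (cases n) auto
  define N where "N = Suc k * n"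
  define R where "R = gf (first_row_kept n ` {K \<in> tilings (seg 1 1 N). Domino 1 (n - 1) \<in> K})"
  let ?Z = "\<lambda>x. \<Sum>P\<in>outcomes N x 1. wt P"
  have N: "N = Suc (k * n + x)" by (simp add: N_def n)
  have sub: "inside (seg 1 1 N) (first_row_kept n K)" if "K \<in> tilings (seg 1 1 N)" for K
    using inside_seg[OF that] by (auto simp: inside_def first_row_kept_def)
  have Z: "(\<Sum>P\<in>fc_partial_tilings n k. wt P) = ?Z x + R * ?Z (n - 2)"
  proof -
    let ?G = "first_row_kept n ` {K \<in> tilings (seg 1 1 N). Domino 1 (n - 1) \<in> K}"
    have "(\<Sum>P\<in>fc_partial_tilings n k. wt P) = gf {{}} * ?Z (n - 1) + gf ?G * ?Z (n - 2)"
      using sum_wt_prepend_union[of "{{}}" 0 1 N ?G "n - 1" N "n - 2"] sub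
        fc_partial_tilings_eq[of n k, OF _ assms, folded N_def] n
      by (auto simp: finite_tilings inside_def)
    thus ?thesis by (simp add: R_def n)
  qed
  have Zx: "?Z x * (lucas_fact x * lucas_fact (k * n)) = lucas_fact (k * n + x)"
    using sum_wt_outcomes[of 1 N x] N by simp
  have step: "lucas n * lucas (Suc (k * n)) + lucas_t * lucas x * lucas (k * n) = lucas N"
    using lucas_add[of x "k * n"] N n by (simp add: add.commute)
  show ?thesis
  proof (cases x)
    case 0
    \<comment> \<open>For \<open>n = 1\<close> the path starts on the left border and cannot go west, so the truncated
        abscissa \<open>n - 2\<close> only occurs with coefficient \<open>0\<close>.\<close>
    have "{K \<in> tilings (seg 1 1 N). Domino 1 (n - 1) \<in> K} = {}"
      by (rule no_domino_out_of_seg) (use 0 n in auto)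
    hence R: "R = 0" unfolding R_def by (simp only: image_empty gf_def sum.empty)
    have "(\<Sum>P\<in>fc_partial_tilings n k. wt P) * (lucas_fact n * lucas_fact (Suc (k * n))) =
        lucas (Suc (k * n)) * (?Z x * (lucas_fact x * lucas_fact (k * n)))"
      unfolding Z R by (simp add: n 0 lucas_fact_Suc)
    also have "\<dots> = lucas_fact N" unfolding Zx by (simp add: N 0 lucas_fact_Suc)
    finally show ?thesis by (simp only: N_def)
  next
    case (Suc x')
    have R: "lucas n * R = lucas_t * lucas (k * n)"
      using gf_first_row_kept[of n k] assms Suc n by (simp add: R_def N_def)
    have Zx': "?Z x' * (lucas_fact x' * lucas_fact (Suc (k * n))) = lucas_fact (k * n + x)"
      using sum_wt_outcomes[of 1 N x'] N Suc by simp
    have regroup: "(z + r * z') * (f * h) = l * c * (z * (f' * g)) + m * (l * r) * (z' * (f'' * h))"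
      if "f = l * f'" "f' = m * f''" "h = c * g" for c f f' f'' g h l m r z z' :: "int poly poly"
      using that by (simp add: algebra_simps)
    have "(\<Sum>P\<in>fc_partial_tilings n k. wt P) * (lucas_fact n * lucas_fact (Suc (k * n))) =
        lucas n * lucas (Suc (k * n)) * (?Z x * (lucas_fact x * lucas_fact (k * n))) +
        lucas x * (lucas n * R) * (?Z x' * (lucas_fact x' * lucas_fact (Suc (k * n))))"
    proof -
      have "n - 2 = x'" using n Suc by simp
      thus ?thesis unfolding Z
        by (simp only:) (rule regroup; simp only: n Suc lucas_fact_Suc)
    qed
    also have "\<dots> = lucas N * lucas_fact (k * n + x)"
      unfolding Zx Zx' R step[symmetric] by (simp add: algebra_simps)
    also have "\<dots> = lucas_fact N" by (simp only: N lucas_fact_Suc)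
    finally show ?thesis by (simp only: N_def)
  qed
qed

section \<open>Coefficients\<close>

definition nat_coeffs :: "int poly poly \<Rightarrow> bool" where
  "nat_coeffs p \<longleftrightarrow> (\<forall>i j. coeff (coeff p i) j \<in> \<nat>)"

lemma sum_in_Nats: "(\<And>x. x \<in> A \<Longrightarrow> f x \<in> \<nat>) \<Longrightarrow> sum f A \<in> (\<nat> :: int set)"
  by (induction A rule: infinite_finite_induct) auto

lemma nat_coeffs_sum: "(\<And>x. x \<in> A \<Longrightarrow> nat_coeffs (f x)) \<Longrightarrow> nat_coeffs (\<Sum>x\<in>A. f x)"
  by (induction A rule: infinite_finite_induct) (auto simp: nat_coeffs_def)

lemma nat_coeffs_mult: "nat_coeffs p \<Longrightarrow> nat_coeffs q \<Longrightarrow> nat_coeffs (p * q)"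
  unfolding nat_coeffs_def
  by (auto simp: coeff_mult coeff_sum intro!: sum_in_Nats Nats_mult)

lemma nat_coeffs_power: "nat_coeffs p \<Longrightarrow> nat_coeffs (p ^ m)"
proof (induction m)
  case 0
  show ?case by (auto simp: nat_coeffs_def coeff_1)
qed (auto intro: nat_coeffs_mult)

lemma nat_coeffs_wt: "nat_coeffs (wt P)"
proof -
  have "nat_coeffs lucas_s" "nat_coeffs lucas_t"
    by (auto simp: nat_coeffs_def lucas_s_def lucas_t_def coeff_pCons split: nat.split)
  thus ?thesis unfolding wt_def by (intro nat_coeffs_mult nat_coeffs_power)
qed

theorem corollary4p5:
  fixes n k :: nat
  assumes "1 \<le> k"
  shows "lucas_fuss_catalan n k = to_fract (\<Sum>P\<in>fc_partial_tilings n k. wt P) \<and>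
         lucas_fuss_catalan n k \<in> nat_polys"
proof -
  let ?S = "\<Sum>P\<in>fc_partial_tilings n k. wt P"
  have "to_fract (lucas_fact (Suc k * n)) =
      to_fract ?S * (to_fract (lucas_fact n) * (to_fract (lucas (Suc (k * n))) * to_fract (lucas_fact (k * n))))"
    unfolding sum_wt_fc_partial_tilings[OF assms, of n, symmetric] lucas_fact_Suc
    by (simp only: to_fract_mult)
  hence "lucas_fuss_catalan n k = to_fract ?S"
    unfolding lucas_fuss_catalan_def lucasnomial_def
    using lucas_neq_0[of "k * n"] lucas_fact_neq_0[of n] lucas_fact_neq_0[of "k * n"]
    by (simp add: field_simps)
  moreover have "to_fract ?S \<in> nat_polys"
    using nat_coeffs_sum[where f = wt, OF nat_coeffs_wt, of "fc_partial_tilings n k"]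
    unfolding nat_polys_def nat_coeffs_def by blast
  ultimately show ?thesis by simp
qed

end
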